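(* Let $\|\cdot\|_Z$ be a strictly monotone norm on $\mathbb{R}^2$. Let $X$ be a Banach space with the weak fixed point property (WFPP), and let $Y$ be a Banach space with the generalized Gossez-Lami Dozo property (GGLD). Then the direct sum $X\oplus_Z Y$ has the weak fixed point property.
   Context: A mapping $T:C\to C$ on a subset $C$ of a Banach space is nonexpansive if $\|Tx-Ty\|\le\|x-y\|$ for all $x,y\in C$. A Banach space has the weak fixed point property (WFPP) if every nonexpansive self-mapping of a nonempty weakly compact convex subset of it has a fixed point. A norm $\|\cdot\|$ on $\mathbb{R}^2$ is strictly monotone if $\|(x_1,y_1)\|<\|(x_2,y_2)\|$ whenever either $0\le x_1\le x_2$ and $0\le y_1<y_2$, or $0\le x_1<x_2$ and $0\le y_1\le y_2$. For a normed space $Z=(\mathbb{R}^2,\|\cdot\|_Z)$ and Banach spaces $X,Y$, $X\oplus_Z Y$ denotes $X\times Y$ with the norm $\|(x,y)\|=\|(\|x\|,\|y\|)\|_Z$. A Banach space $Y$ has the generalized Gossez-Lami Dozo property (GGLD) if $\limsup_{m\to\infty}\limsup_{n\to\infty}\|x_n-x_m\|>1$ whenever $(x_n)$ is a sequence in $Y$ converging weakly to $0$ with $\lim_{n\to\infty}\|x_n\|=1$. *)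

theory Defs
  imports "HOL-Analysis.Analysis"
begin

text \<open>
  The norm on a direct sum depends on the parameter \<^term>\<open>nZ\<close>, so it cannot be the
  type-class norm of the product type. All notions are therefore relative to an explicit norm
  function \<^term>\<open>N\<close> on a real vector space; a Banach space in the type-class sense is the
  instance \<^term>\<open>N = norm\<close>.
\<close>

definition is_norm :: "('v::real_vector \<Rightarrow> real) \<Rightarrow> bool" where
  "is_norm N \<longleftrightarrow>
     (\<forall>x. N x = 0 \<longleftrightarrow> x = 0) \<and>
     (\<forall>a x. N (a *\<^sub>R x) = \<bar>a\<bar> * N x) \<and>
     (\<forall>x y. N (x + y) \<le> N x + N y)"

definition is_complete_norm :: "('v::real_vector \<Rightarrow> real) \<Rightarrow> bool" where
  "is_complete_norm N \<longleftrightarrow> is_norm N \<and>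
     (\<forall>s. (\<forall>e>0. \<exists>M. \<forall>m\<ge>M. \<forall>n\<ge>M. N (s m - s n) < e) \<longrightarrow>
          (\<exists>l. (\<lambda>n. N (s n - l)) \<longlonglongrightarrow> 0))"

definition bounded_functional :: "('v::real_vector \<Rightarrow> real) \<Rightarrow> ('v \<Rightarrow> real) \<Rightarrow> bool" where
  "bounded_functional N f \<longleftrightarrow> linear f \<and> (\<exists>K. \<forall>x. \<bar>f x\<bar> \<le> K * N x)"

definition weak_topology :: "('v::real_vector \<Rightarrow> real) \<Rightarrow> 'v topology" where
  "weak_topology N = topology_generated_by {f -` U |f U. bounded_functional N f \<and> open U}"

definition nonexpansive_on :: "('v::real_vector \<Rightarrow> real) \<Rightarrow> 'v set \<Rightarrow> ('v \<Rightarrow> 'v) \<Rightarrow> bool" where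
  "nonexpansive_on N C T \<longleftrightarrow> (\<forall>x\<in>C. \<forall>y\<in>C. N (T x - T y) \<le> N (x - y))"

definition WFPP :: "('v::real_vector \<Rightarrow> real) \<Rightarrow> bool" where
  "WFPP N \<longleftrightarrow>
     (\<forall>C T. C \<noteq> {} \<and> compactin (weak_topology N) C \<and> convex C \<and>
            T ` C \<subseteq> C \<and> nonexpansive_on N C T \<longrightarrow> (\<exists>x\<in>C. T x = x))"

definition GGLD :: "('v::real_vector \<Rightarrow> real) \<Rightarrow> bool" where
  "GGLD N \<longleftrightarrow>
     (\<forall>x. limitin (weak_topology N) x 0 sequentially \<and> (\<lambda>n. N (x n)) \<longlonglongrightarrow> 1 \<longrightarrow>
          limsup (\<lambda>m. limsup (\<lambda>n. ereal (N (x n - x m)))) > 1)"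

definition strictly_monotone_norm :: "(real \<times> real \<Rightarrow> real) \<Rightarrow> bool" where
  "strictly_monotone_norm N \<longleftrightarrow> is_norm N \<and>
     (\<forall>x1 y1 x2 y2.
        (0 \<le> x1 \<and> x1 \<le> x2 \<and> 0 \<le> y1 \<and> y1 < y2) \<or>
        (0 \<le> x1 \<and> x1 < x2 \<and> 0 \<le> y1 \<and> y1 \<le> y2) \<longrightarrow> N (x1, y1) < N (x2, y2))"

definition direct_sum_norm ::
  "(real \<times> real \<Rightarrow> real) \<Rightarrow> 'a::real_normed_vector \<times> 'b::real_normed_vector \<Rightarrow> real" where
  "direct_sum_norm nZ = (\<lambda>(x, y). nZ (norm x, norm y))"

lemma bounded_functional_norm: "bounded_functional norm f \<longleftrightarrow> bounded_linear f"
  by (auto simp: bounded_functional_def bounded_linear_def bounded_linear_axioms_def mult.commute)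

lemma topspace_weak_topology [simp]: "topspace (weak_topology N) = UNIV"
proof -
  have "bounded_functional N (\<lambda>_. 0)"
    by (auto simp: bounded_functional_def linear_iff intro: exI[of _ 0])
  then have "UNIV \<in> {f -` U |f U. bounded_functional N f \<and> open U}"
    by (auto intro!: exI[of _ "\<lambda>_. 0"] exI[of _ UNIV])
  then show ?thesis
    unfolding weak_topology_def topology_generated_by_topspace by blast
qed

lemma limitin_weak_topology:
  "limitin (weak_topology N) x l F \<longleftrightarrow>
     (\<forall>f. bounded_functional N f \<longrightarrow> ((\<lambda>n. f (x n)) \<longlongrightarrow> f l) F)"
proof (intro iffI allI impI)
  fix f assume lim: "limitin (weak_topology N) x l F" and f: "bounded_functional N f"
  show "((\<lambda>n. f (x n)) \<longlongrightarrow> f l) F"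
  proof (rule topological_tendstoI)
    fix U :: "real set" assume U: "open U" "f l \<in> U"
    have "openin (weak_topology N) (f -` U)"
      unfolding weak_topology_def using f U by (intro topology_generated_by_Basis) auto
    then show "\<forall>\<^sub>F n in F. f (x n) \<in> U"
      using lim U by (auto simp: limitin_def)
  qed
next
  assume conv: "\<forall>f. bounded_functional N f \<longrightarrow> ((\<lambda>n. f (x n)) \<longlongrightarrow> f l) F"
  have "\<forall>\<^sub>F n in F. x n \<in> W"
    if "generate_topology_on {f -` U |f U. bounded_functional N f \<and> open U} W" "l \<in> W" for W
    using that
  proof (induction W rule: generate_topology_on.induct)
    case (UN K)
    then obtain k where k: "k \<in> K" "l \<in> k" by auto
    with UN have "\<forall>\<^sub>F n in F. x n \<in> k" by blast
    then show ?case by (rule eventually_mono) (use k in auto)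
  next
    case (Basis s)
    then obtain f U where s: "s = f -` U" "bounded_functional N f" "open U" by auto
    with conv Basis show ?case by (auto dest: topological_tendstoD)
  qed (auto intro: eventually_conj)
  then show "limitin (weak_topology N) x l F"
    unfolding limitin_def topspace_weak_topology
    by (auto simp: weak_topology_def openin_topology_generated_by_iff)
qed

lemma strictly_monotone_norm_mono:
  assumes "strictly_monotone_norm N" "0 \<le> a" "a \<le> c" "0 \<le> b" "b \<le> d"
  shows "N (a, b) \<le> N (c, d)"
proof (cases "a = c \<and> b = d")
  case False
  with assms have "N (a, b) < N (c, d)"
    unfolding strictly_monotone_norm_def by (metis order_less_le)
  then show ?thesis by simp
qed simp

lemma is_norm_direct_sum_norm:
  assumes Z: "strictly_monotone_norm nZ"
  shows "is_norm (direct_sum_norm nZ :: 'a::real_normed_vector \<times> 'b::real_normed_vector \<Rightarrow> real)"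
proof -
  have nz: "is_norm nZ" using Z by (simp add: strictly_monotone_norm_def)
  have "nZ (norm (x + x'), norm (y + y')) \<le> nZ (norm x, norm y) + nZ (norm x', norm y')"
    for x x' :: 'a and y y' :: 'b
  proof -
    have "nZ (norm (x + x'), norm (y + y')) \<le> nZ ((norm x, norm y) + (norm x', norm y'))"
      unfolding add_Pair by (intro strictly_monotone_norm_mono[OF Z]) (auto intro: norm_triangle_ineq)
    also have "\<dots> \<le> nZ (norm x, norm y) + nZ (norm x', norm y')"
      using nz unfolding is_norm_def by blast
    finally show ?thesis .
  qed
  moreover have "nZ (norm (a *\<^sub>R x), norm (a *\<^sub>R y)) = \<bar>a\<bar> * nZ (norm x, norm y)"
    for a and x :: 'a and y :: 'b
  proof -
    have "nZ (\<bar>a\<bar> *\<^sub>R (norm x, norm y)) = \<bar>a\<bar> * nZ (norm x, norm y)"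
      using nz unfolding is_norm_def by (metis abs_abs)
    then show ?thesis by simp
  qed
  moreover have "nZ (norm x, norm y) = 0 \<longleftrightarrow> x = 0 \<and> y = 0" for x :: 'a and y :: 'b
  proof -
    have "nZ (norm x, norm y) = 0 \<longleftrightarrow> (norm x, norm y) = 0"
      using nz unfolding is_norm_def by blast
    then show ?thesis by (simp add: zero_prod_def)
  qed
  ultimately show ?thesis
    by (auto simp: is_norm_def direct_sum_norm_def zero_prod_def split: prod.splits)
qed

text \<open>The direct sum of two Banach spaces is again a Banach space, as \<^term>\<open>WFPP\<close> presupposes.\<close>

lemma is_complete_norm_direct_sum_norm:
  assumes Z: "strictly_monotone_norm nZ"
  shows "is_complete_norm (direct_sum_norm nZ :: 'a::banach \<times> 'b::banach \<Rightarrow> real)"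
  unfolding is_complete_norm_def
proof (intro conjI allI impI)
  show "is_norm (direct_sum_norm nZ :: 'a \<times> 'b \<Rightarrow> real)"
    by (rule is_norm_direct_sum_norm[OF Z])
  have nz: "is_norm nZ" using Z by (simp add: strictly_monotone_norm_def)
  define p q where "p = nZ (1, 0)" and "q = nZ (0, 1)"
  have zero: "nZ (0, 0) = 0" using nz by (simp add: is_norm_def zero_prod_def)
  have pq: "p > 0" "q > 0"
    using Z zero unfolding strictly_monotone_norm_def p_def q_def
    by (metis order_refl zero_less_one zero_le_one)+
  have axes: "nZ (a, 0) = \<bar>a\<bar> * p" "nZ (0, a) = \<bar>a\<bar> * q" for a
    using nz unfolding is_norm_def p_def q_def
    by (metis mult.right_neutral mult_zero_right real_scaleR_def scaleR_Pair)+
  have lower: "norm x * p \<le> nZ (norm x, norm y)" "norm y * q \<le> nZ (norm x, norm y)"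
    for x :: 'a and y :: 'b
    using strictly_monotone_norm_mono[OF Z, of "norm x" "norm x" 0 "norm y"]
      strictly_monotone_norm_mono[OF Z, of 0 "norm x" "norm y" "norm y"]
    by (auto simp: axes)
  have upper: "nZ (norm x, norm y) \<le> norm x * p + norm y * q" for x :: 'a and y :: 'b
  proof -
    have "nZ ((norm x, 0) + (0, norm y)) \<le> nZ (norm x, 0) + nZ (0, norm y)"
      using nz unfolding is_norm_def by blast
    then show ?thesis by (simp add: axes)
  qed
  fix s :: "nat \<Rightarrow> 'a \<times> 'b"
  assume cau: "\<forall>e>0. \<exists>M. \<forall>m\<ge>M. \<forall>n\<ge>M. direct_sum_norm nZ (s m - s n) < e"
  have D: "direct_sum_norm nZ (u - v) = nZ (norm (fst u - fst v), norm (snd u - snd v))"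
    for u v :: "'a \<times> 'b"
    by (simp add: direct_sum_norm_def split_beta)
  have "Cauchy (\<lambda>n. fst (s n))"
  proof (rule CauchyI)
    fix e :: real assume "e > 0"
    with pq cau obtain M where "\<forall>m\<ge>M. \<forall>n\<ge>M. direct_sum_norm nZ (s m - s n) < e * p"
      by (meson mult_pos_pos)
    then have "\<forall>m\<ge>M. \<forall>n\<ge>M. norm (fst (s m) - fst (s n)) * p < e * p"
      unfolding D using lower(1) order_le_less_trans by blast
    then show "\<exists>M. \<forall>m\<ge>M. \<forall>n\<ge>M. norm (fst (s m) - fst (s n)) < e"
      using pq by auto
  qed
  then obtain a where a: "(\<lambda>n. fst (s n)) \<longlonglongrightarrow> a"
    by (auto simp: Cauchy_convergent_iff convergent_def)
  have "Cauchy (\<lambda>n. snd (s n))"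
  proof (rule CauchyI)
    fix e :: real assume "e > 0"
    with pq cau obtain M where "\<forall>m\<ge>M. \<forall>n\<ge>M. direct_sum_norm nZ (s m - s n) < e * q"
      by (meson mult_pos_pos)
    then have "\<forall>m\<ge>M. \<forall>n\<ge>M. norm (snd (s m) - snd (s n)) * q < e * q"
      unfolding D using lower(2) order_le_less_trans by blast
    then show "\<exists>M. \<forall>m\<ge>M. \<forall>n\<ge>M. norm (snd (s m) - snd (s n)) < e"
      using pq by auto
  qed
  then obtain b where b: "(\<lambda>n. snd (s n)) \<longlonglongrightarrow> b"
    by (auto simp: Cauchy_convergent_iff convergent_def)
  have up: "(\<lambda>n. norm (fst (s n) - a) * p + norm (snd (s n) - b) * q) \<longlonglongrightarrow> 0"
    using tendsto_add[OF tendsto_mult_right_zero[OF tendsto_norm_zero[OF LIM_zero[OF a]]]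
        tendsto_mult_right_zero[OF tendsto_norm_zero[OF LIM_zero[OF b]]], of p q]
    by (simp add: mult.commute)
  have "(\<lambda>n. direct_sum_norm nZ (s n - (a, b))) \<longlonglongrightarrow> 0"
  proof (rule tendsto_sandwich[OF _ _ tendsto_const up]; intro always_eventually allI)
    fix n
    show "0 \<le> direct_sum_norm nZ (s n - (a, b))"
      unfolding D using lower(1) pq by (meson mult_nonneg_nonneg norm_ge_zero order_trans less_imp_le)
    show "direct_sum_norm nZ (s n - (a, b)) \<le> norm (fst (s n) - a) * p + norm (snd (s n) - b) * q"
      unfolding D using upper by simp
  qed
  then show "\<exists>l. (\<lambda>n. direct_sum_norm nZ (s n - l)) \<longlonglongrightarrow> 0" by blast
qed

end

theory Submission
  imports Defs
begin

text \<open>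
  Let \<open>C\<close> be a nonempty weakly compact convex subset of the direct sum and \<open>T\<close> a nonexpansive
  self-map of \<open>C\<close>. By Zorn's lemma \<open>C\<close> may be taken minimal among the nonempty closed convex sets
  that \<open>T\<close> maps into themselves. It is enough to show that then all points of \<open>C\<close> have the same
  second coordinate \<open>y0\<close> (\<open>minimal_invariant_snd_constant\<close>): up to the factor \<open>nZ (1, 0)\<close> the set
  \<open>C\<close> is an isometric copy of a weakly compact convex subset of the first summand, and the weak
  fixed point property of that space provides the fixed point.

  Take an approximate fixed point sequence \<open>w\<close> for \<open>T\<close> that converges weakly to some \<open>l\<close> in \<open>C\<close>; the
  Eberlein-Smulian theorem gives such a subsequence. By the Goebel-Karlovitz lemma the distances
  \<open>N (w n - u)\<close> tend to one and the same number \<open>d\<close> for all \<open>u\<close> in \<open>C\<close>. Two consequences are drawn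
  from strict monotonicity. First, the second coordinates of \<open>w\<close> converge in norm to
  \<open>snd l\<close>: otherwise GGLD makes the second coordinates of \<open>w n - w m\<close> asymptotically longer than those
  of \<open>w n - l\<close>, the first coordinates are not asymptotically shorter by weak lower semicontinuity of the
  norm, and so the limit distances could not both be \<open>d\<close> (\<open>GGLD_imp_snd_tendsto\<close>).

  Second, let \<open>S\<close> be any nonexpansive self-map of \<open>C\<close> for which \<open>w\<close> is an approximate fixed point
  sequence, and let \<open>v\<close> lie on the segment from \<open>u\<close> to \<open>w n\<close> with \<open>n\<close> large. Both \<open>N (w n - u)\<close> and
  \<open>N (w n - S u)\<close> are close to \<open>d\<close>, and \<open>S\<close> does not expand the two parts of the segment; so \<open>S v\<close>
  lies almost on a metric segment from \<open>S u\<close> to \<open>w n\<close>. Strict monotonicity transfers this to the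
  second coordinates, and \<open>snd (S v)\<close> cannot be essentially farther from \<open>snd l\<close> than \<open>snd (S u)\<close> is
  (\<open>snd_descends_along_segments\<close>). Starting near the sequence and adding further terms one at a time,
  one gets a convex set that contains infinitely many \<open>w n\<close> and on which \<open>snd (S u)\<close> stays near
  \<open>snd l\<close>. By Mazur's theorem \<open>l\<close> is in its norm closure, whence \<open>snd (S l) = snd l\<close>
  (\<open>weak_limit_le_if_segments_descend\<close>).

  Finally, the maps \<open>S\<close> of this kind contain the identity and are stable under composition with \<open>T\<close> and
  under convex combinations. Hence the points \<open>S l\<close> form a convex \<open>T\<close>-invariant set, which is dense in
  \<open>C\<close> by minimality (\<open>minimal_set_in_closure_of_orbit\<close>), and \<open>snd\<close> is constant on \<open>C\<close>.
\<close>

section \<open>The Hahn-Banach theorem from minimal sublinear functionals\<close>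

definition sublinear :: "('v::real_vector \<Rightarrow> real) \<Rightarrow> bool" where
  "sublinear p \<longleftrightarrow>
     (\<forall>x y. p (x + y) \<le> p x + p y) \<and> (\<forall>t\<ge>0. \<forall>x. p (t *\<^sub>R x) = t * p x)"

lemma sublinearI:
  assumes zero: "p 0 = 0"
    and add: "\<And>x y. p (x + y) \<le> p x + p y"
    and scale: "\<And>t x. t > 0 \<Longrightarrow> p (t *\<^sub>R x) \<le> t * p x"
  shows "sublinear p"
  unfolding sublinear_def
proof (intro conjI allI impI add)
  fix t :: real and x assume "0 \<le> t"
  show "p (t *\<^sub>R x) = t * p x"
  proof (cases "t = 0")
    case False
    with \<open>0 \<le> t\<close> have t: "t > 0" by simp
    have "p x \<le> inverse t * p (t *\<^sub>R x)"
      using scale[of "inverse t" "t *\<^sub>R x"] t by simp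
    with t have "t * p x \<le> p (t *\<^sub>R x)" by (simp add: field_simps)
    with scale[OF t, of x] show ?thesis by simp
  qed (simp add: zero)
qed

lemma sublinear_zero: "sublinear p \<Longrightarrow> p 0 = 0"
  unfolding sublinear_def by (metis mult_zero_left order_refl scale_zero_left)

lemma sublinear_lower:
  assumes "sublinear p"
  shows "- p (- x) \<le> p x"
proof -
  have "p (x + - x) \<le> p x + p (- x)" using assms unfolding sublinear_def by blast
  then show ?thesis using sublinear_zero[OF assms] by simp
qed

lemma sublinear_norm: "sublinear (norm :: 'v::real_normed_vector \<Rightarrow> real)"
  by (simp add: sublinear_def norm_triangle_ineq)

text \<open>
The Mazur-Orlicz construction: push \<open>q\<close> down along the directions in \<open>S\<close> at the rate \<open>\<delta>\<close> that
  \<open>q \<ge> \<delta>\<close> on \<open>S\<close> allows. The infimum is finite because \<open>q (x + t *\<^sub>R c) - t * \<delta> \<ge> - q (- x)\<close>, and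
  subadditive because two multiples \<open>s *\<^sub>R c\<close> and \<open>t *\<^sub>R d\<close> of points of the convex set \<open>S\<close> add up to
  \<open>s + t\<close> times a point of \<open>S\<close>. A singleton \<open>S\<close> yields norming functionals, a general \<open>S\<close> yields
  separation of convex sets.
\<close>

lemma sublinear_envelope:
  fixes q :: "'v::real_vector \<Rightarrow> real"
  assumes q: "sublinear q" and S: "convex S" "S \<noteq> {}" and \<delta>: "\<And>c. c \<in> S \<Longrightarrow> \<delta> \<le> q c"
  obtains p where "sublinear p" "\<And>x. p x \<le> q x" "\<And>c. c \<in> S \<Longrightarrow> p (- c) \<le> - \<delta>"
proof -
  have q_add: "q (x + y) \<le> q x + q y" and q_scale: "t \<ge> 0 \<Longrightarrow> q (t *\<^sub>R x) = t * q x" for t x y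
    using q by (auto simp: sublinear_def)
  define G where "G x = {q (x + t *\<^sub>R c) - t * \<delta> | t c. 0 \<le> t \<and> c \<in> S}" for x
  define p where "p x = Inf (G x)" for x
  have G_lower: "- q (- x) \<le> g" if g: "g \<in> G x" for g x
  proof -
    obtain t c where tc: "g = q (x + t *\<^sub>R c) - t * \<delta>" "0 \<le> t" "c \<in> S"
      using g unfolding G_def by blast
    have "t * \<delta> \<le> q (t *\<^sub>R c)" using tc \<delta> by (simp add: q_scale mult_left_mono)
    also have "\<dots> \<le> q (x + t *\<^sub>R c) + q (- x)" using q_add[of "x + t *\<^sub>R c" "- x"] by simp
    finally show ?thesis using tc by simp
  qed
  have p_le: "p x \<le> q (x + t *\<^sub>R c) - t * \<delta>" if "0 \<le> t" "c \<in> S" for x t c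
    unfolding p_def
    by (rule cInf_lower) (use that in \<open>auto simp: G_def intro!: bdd_belowI[of _ "- q (- x)"] G_lower[unfolded G_def]\<close>)
  have p_ge: "m \<le> p x" if "\<And>t c. 0 \<le> t \<Longrightarrow> c \<in> S \<Longrightarrow> m \<le> q (x + t *\<^sub>R c) - t * \<delta>" for m x
    unfolding p_def
    by (rule cInf_greatest) (use that S in \<open>force simp: G_def\<close>)+
  obtain c0 where c0: "c0 \<in> S" using S by blast
  have p_le_q: "p x \<le> q x" for x using p_le[of 0 c0 x] c0 by simp
  have "sublinear p"
  proof (rule sublinearI)
    have "G 0 \<noteq> {}" using c0 by (force simp: G_def)
    then have "- q (- 0) \<le> p 0" unfolding p_def using G_lower by (rule cInf_greatest)
    then show "p 0 = 0" using p_le_q[of 0] sublinear_zero[OF q] by simp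
  next
    fix x y
    have key: "p (x + y) \<le> (q (x + s *\<^sub>R c) - s * \<delta>) + (q (y + t *\<^sub>R d) - t * \<delta>)"
      if st: "0 \<le> s" "c \<in> S" "0 \<le> t" "d \<in> S" for s t c d
    proof (cases "s + t = 0")
      case True
      with st have "s = 0" "t = 0" by auto
      then show ?thesis using p_le_q[of "x + y"] q_add[of x y] by simp
    next
      case False
      with st have pos: "s + t > 0" by simp
      define e where "e = (s / (s + t)) *\<^sub>R c + (t / (s + t)) *\<^sub>R d"
      have "e \<in> S" unfolding e_def
        by (rule convexD[OF S(1)]) (use st pos in \<open>auto simp: add_divide_distrib[symmetric]\<close>)
      have e: "(s + t) *\<^sub>R e = s *\<^sub>R c + t *\<^sub>R d"
        using pos by (simp add: e_def scaleR_add_right)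
      have "p (x + y) \<le> q ((x + y) + (s + t) *\<^sub>R e) - (s + t) * \<delta>"
        by (rule p_le) (use pos \<open>e \<in> S\<close> in auto)
      also have "(x + y) + (s + t) *\<^sub>R e = (x + s *\<^sub>R c) + (y + t *\<^sub>R d)"
        unfolding e by (simp add: algebra_simps)
      also have "q \<dots> - (s + t) * \<delta> \<le> (q (x + s *\<^sub>R c) - s * \<delta>) + (q (y + t *\<^sub>R d) - t * \<delta>)"
        using q_add[of "x + s *\<^sub>R c" "y + t *\<^sub>R d"] by (simp add: algebra_simps)
      finally show ?thesis .
    qed
    have "p (x + y) - (q (x + s *\<^sub>R c) - s * \<delta>) \<le> p y" if "0 \<le> s" "c \<in> S" for s c
      by (rule p_ge) (use key that in \<open>fastforce simp: algebra_simps\<close>)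
    then have "p (x + y) - p y \<le> p x"
      by (intro p_ge) (fastforce simp: algebra_simps)
    then show "p (x + y) \<le> p x + p y" by simp
  next
    fix r :: real and x assume r: "r > 0"
    have "inverse r * p (r *\<^sub>R x) \<le> p x"
    proof (rule p_ge)
      fix t :: real and c assume tc: "0 \<le> t" "c \<in> S"
      have "p (r *\<^sub>R x) \<le> q (r *\<^sub>R x + (r * t) *\<^sub>R c) - (r * t) * \<delta>"
        by (rule p_le) (use r tc in auto)
      also have "r *\<^sub>R x + (r * t) *\<^sub>R c = r *\<^sub>R (x + t *\<^sub>R c)" by (simp add: scaleR_add_right)
      also have "q \<dots> - (r * t) * \<delta> = r * (q (x + t *\<^sub>R c) - t * \<delta>)"
        using r q_scale[of r "x + t *\<^sub>R c"] by (simp only: right_diff_distrib mult.assoc)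
      finally show "inverse r * p (r *\<^sub>R x) \<le> q (x + t *\<^sub>R c) - t * \<delta>"
        using r by (metis divide_inverse_commute mult.commute pos_divide_le_eq)
    qed
    with r show "p (r *\<^sub>R x) \<le> r * p x" by (simp add: field_simps)
  qed
  moreover have "p (- c) \<le> - \<delta>" if "c \<in> S" for c
    using p_le[of 1 c "- c"] that sublinear_zero[OF q] by simp
  ultimately show ?thesis using p_le_q that by blast
qed

text \<open>
Pushing \<open>q\<close> down along the single direction \<open>v\<close> does not change a minimal \<open>q\<close>, so
  \<open>q (- v) \<le> - q v\<close>; together with subadditivity this makes \<open>q\<close> odd and hence additive.
\<close>

lemma linear_if_minimal_sublinear:
  assumes q: "sublinear q" and min: "\<And>p. sublinear p \<Longrightarrow> (\<And>x. p x \<le> q x) \<Longrightarrow> p = q"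
  shows "linear q"
proof -
  have odd: "q (- v) = - q v" for v
  proof -
    obtain p where p: "sublinear p" "\<And>x. p x \<le> q x" "p (- v) \<le> - q v"
      using sublinear_envelope[OF q, of "{v}" "q v"] by auto
    with min have "p = q" by blast
    then show ?thesis using p(3) sublinear_lower[OF q, of v] by simp
  qed
  have "q x + q y \<le> q (x + y)" for x y
  proof -
    have "q ((x + y) + - y) \<le> q (x + y) + q (- y)" using q unfolding sublinear_def by blast
    then show ?thesis using odd[of y] by simp
  qed
  then have add: "q (x + y) = q x + q y" for x y
    using q by (auto simp: sublinear_def intro: antisym)
  moreover have "q (t *\<^sub>R x) = t * q x" for t x
  proof (cases "0 \<le> t")
    case False
    then have "q (t *\<^sub>R x) = - q ((- t) *\<^sub>R x)" using odd[of "t *\<^sub>R x"] by simp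
    also have "q ((- t) *\<^sub>R x) = - t * q x"
      using q False unfolding sublinear_def by (meson linorder_le_cases neg_0_le_iff_le)
    finally show ?thesis by simp
  qed (use q in \<open>simp add: sublinear_def\<close>)
  ultimately show ?thesis by (simp add: linear_iff)
qed

text \<open>
Zorn's lemma gives a minimal sublinear function below \<open>p\<close>: the pointwise infimum of a chain is
  finite, since all members are bounded below by \<open>- p (- x)\<close> at \<open>x\<close>, and it is subadditive because two
  members of a chain have a common lower bound in the chain.
\<close>

lemma linear_below_sublinear:
  fixes p :: "'v::real_vector \<Rightarrow> real"
  assumes p: "sublinear p"
  obtains f where "linear f" "\<And>x. f x \<le> p x"
proof -
  define A where "A = {q. sublinear q \<and> q \<le> p}"
  have "\<exists>m\<in>A. \<forall>a\<in>A. a \<le> m \<longrightarrow> a = m"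
  proof (rule predicate_Zorn)
    show "partial_order_on A (relation_of (\<lambda>a b. b \<le> a) A)"
      by (rule partial_order_on_relation_ofI) auto
  next
    fix \<C> assume "\<C> \<in> Chains (relation_of (\<lambda>a b. b \<le> a) A)"
    then have CA: "\<And>q. q \<in> \<C> \<Longrightarrow> sublinear q \<and> q \<le> p"
      and chain: "\<And>q r. q \<in> \<C> \<Longrightarrow> r \<in> \<C> \<Longrightarrow> q \<le> r \<or> r \<le> q"
      unfolding Chains_def relation_of_def A_def by auto
    show "\<exists>u\<in>A. \<forall>a\<in>\<C>. u \<le> a"
    proof (cases "\<C> = {}")
      case True
      then show ?thesis using p by (auto simp: A_def)
    next
      case False
      define u where "u x = (INF q\<in>\<C>. q x)" for x
      have low: "- p (- x) \<le> q x" if "q \<in> \<C>" for q x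
        using CA[OF that] sublinear_lower[of q x] by (auto simp: le_fun_def dest: spec[of _ "- x"])
      have u_le: "u x \<le> q x" if "q \<in> \<C>" for q x
        unfolding u_def by (rule cINF_lower[OF _ that]) (use low in \<open>auto intro!: bdd_belowI2\<close>)
      have u_ge: "m \<le> u x" if "\<And>q. q \<in> \<C> \<Longrightarrow> m \<le> q x" for m x
        unfolding u_def by (rule cINF_greatest[OF False that])
      have "sublinear u"
      proof (rule sublinearI)
        obtain q where "q \<in> \<C>" using False by blast
        then have "u 0 \<le> 0" using u_le[of q 0] CA sublinear_zero by metis
        moreover have "0 \<le> u 0" by (rule u_ge) (use CA sublinear_zero in fastforce)
        ultimately show "u 0 = 0" by simp
      next
        fix x y
        have key: "u (x + y) \<le> q x + r y" if qr: "q \<in> \<C>" "r \<in> \<C>" for q r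
        proof -
          obtain s where s: "s \<in> \<C>" "s \<le> q" "s \<le> r" using chain qr by blast
          have "u (x + y) \<le> s (x + y)" using u_le s by blast
          also have "\<dots> \<le> s x + s y" using CA[OF s(1)] by (simp add: sublinear_def)
          also have "\<dots> \<le> q x + r y" using s by (simp add: le_fun_def add_mono)
          finally show ?thesis .
        qed
        have "u (x + y) - q x \<le> u y" if "q \<in> \<C>" for q
          by (rule u_ge) (use key that in \<open>fastforce simp: algebra_simps\<close>)
        then have "u (x + y) - u y \<le> u x"
          by (intro u_ge) (fastforce simp: algebra_simps)
        then show "u (x + y) \<le> u x + u y" by simp
      next
        fix t :: real and x assume t: "t > 0"
        have "inverse t * u (t *\<^sub>R x) \<le> u x"
        proof (rule u_ge)
          fix q assume q: "q \<in> \<C>"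
          have "u (t *\<^sub>R x) \<le> q (t *\<^sub>R x)" by (rule u_le[OF q])
          also have "\<dots> = t * q x" using CA[OF q] t by (simp add: sublinear_def)
          finally show "inverse t * u (t *\<^sub>R x) \<le> q x" using t by (simp add: field_simps)
        qed
        with t show "u (t *\<^sub>R x) \<le> t * u x" by (simp add: field_simps)
      qed
      moreover have "u \<le> p"
        using False u_le CA by (fastforce simp: le_fun_def intro: order_trans)
      ultimately show ?thesis using u_le by (auto simp: A_def le_fun_def)
    qed
  qed
  then obtain m where m: "sublinear m" "m \<le> p" "\<And>a. sublinear a \<Longrightarrow> a \<le> p \<Longrightarrow> a \<le> m \<Longrightarrow> a = m"
    unfolding A_def by blast
  have "linear m"
    by (rule linear_if_minimal_sublinear[OF m(1)]) (meson le_funI m(2,3) order_trans)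
  then show ?thesis using that m(2) by (simp add: le_fun_def)
qed

lemma bounded_linear_if_below_norm:
  fixes f :: "'v::real_normed_vector \<Rightarrow> real"
  assumes "linear f" "\<And>x. f x \<le> norm x"
  shows "bounded_linear f" "\<bar>f x\<bar> \<le> norm x"
proof -
  show abs: "\<bar>f x\<bar> \<le> norm x" for x
    using assms(2)[of x] assms(2)[of "- x"] linear_neg[OF assms(1), of x] by (simp add: abs_le_iff)
  show "bounded_linear f"
    using assms(1) abs by (auto simp: bounded_linear_def bounded_linear_axioms_def intro!: exI[of _ 1])
qed

lemma linear_functional_ge_on_convex:
  fixes S :: "'v::real_normed_vector set"
  assumes S: "convex S" and \<delta>: "\<And>c. c \<in> S \<Longrightarrow> \<delta> \<le> norm c"
  obtains f where "bounded_linear f" "\<And>x. \<bar>f x\<bar> \<le> norm x" "\<And>c. c \<in> S \<Longrightarrow> \<delta> \<le> f c"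
proof (cases "S = {}")
  case True
  then show ?thesis using that[of "\<lambda>_. 0"] by simp
next
  case False
  \<comment> \<open>The bound \<open>p (- c) \<le> - \<delta>\<close> on \<open>S\<close> becomes \<open>\<delta> \<le> f c\<close> for every linear \<open>f \<le> p\<close>.\<close>
  obtain p where p: "sublinear p" "\<And>x. p x \<le> norm x" "\<And>c. c \<in> S \<Longrightarrow> p (- c) \<le> - \<delta>"
    using sublinear_envelope[OF sublinear_norm S False \<delta>] by blast
  obtain f where f: "linear f" "\<And>x. f x \<le> p x" using linear_below_sublinear[OF p(1)] by blast
  have fn: "f x \<le> norm x" for x using f(2) p(2) order_trans by blast
  have "\<delta> \<le> f c" if "c \<in> S" for c
    using f(2)[of "- c"] p(3)[OF that] linear_neg[OF f(1), of c] by simp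
  then show ?thesis using that bounded_linear_if_below_norm[OF f(1) fn] by blast
qed

lemma norming_functional:
  fixes z :: "'v::real_normed_vector"
  obtains f where "bounded_linear f" "\<And>x. \<bar>f x\<bar> \<le> norm x" "f z = norm z"
proof -
  obtain f where f: "bounded_linear f" "\<And>x. \<bar>f x\<bar> \<le> norm x" "norm z \<le> f z"
    using linear_functional_ge_on_convex[of "{z}" "norm z"] by auto
  moreover have "f z = norm z" using f(2)[of z] f(3) by linarith
  ultimately show ?thesis using that by blast
qed

lemma separate_point_closed_convex:
  fixes S :: "'v::real_normed_vector set"
  assumes "convex S" "closed S" "z \<notin> S"
  obtains f :: "'v \<Rightarrow> real" and \<delta> where "bounded_linear f" "\<delta> > 0" "\<And>c. c \<in> S \<Longrightarrow> f z + \<delta> \<le> f c"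
proof -
  obtain \<delta> where \<delta>: "\<delta> > 0" "ball z \<delta> \<inter> S = {}"
    using assms(2,3) by (metis Compl_iff disjoint_eq_subset_Compl open_Compl open_contains_ball)
  have "convex ((\<lambda>c. c - z) ` S)"
    using convex_translation_subtract assms(1) by blast
  moreover have "\<delta> \<le> norm d" if "d \<in> (\<lambda>c. c - z) ` S" for d
    using that \<delta>(2) by (force simp: dist_norm norm_minus_commute not_le[symmetric])
  ultimately obtain f where f: "bounded_linear f" "\<And>d. d \<in> (\<lambda>c. c - z) ` S \<Longrightarrow> \<delta> \<le> f d"
    using linear_functional_ge_on_convex by metis
  have "f z + \<delta> \<le> f c" if "c \<in> S" for c
    using f(2)[of "c - z"] that linear_diff[OF bounded_linear.linear[OF f(1)], of c z] by auto
  then show ?thesis by (rule that[OF f(1) \<delta>(1)])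
qed

section \<open>Weak topology and weakly compact sets\<close>

lemma continuous_map_weak_topology:
  fixes f :: "'v::real_normed_vector \<Rightarrow> real"
  assumes "bounded_linear f"
  shows "continuous_map (weak_topology norm) euclideanreal f"
  unfolding continuous_map_def
proof (intro conjI allI impI)
  fix U :: "real set" assume "openin euclideanreal U"
  then have "openin (weak_topology norm) (f -` U)"
    unfolding weak_topology_def using assms
    by (intro topology_generated_by_Basis) (auto simp: bounded_functional_norm)
  then show "openin (weak_topology norm) {x \<in> topspace (weak_topology norm). f x \<in> U}"
    by (simp add: vimage_def)
qed simp

lemma openin_weak_topology_vimage:
  fixes f :: "'v::real_normed_vector \<Rightarrow> real"
  assumes "bounded_linear f" "open U"
  shows "openin (weak_topology norm) {x. f x \<in> U}"
  using openin_continuous_map_preimage[OF continuous_map_weak_topology[OF assms(1)], of U] assms(2)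
  by simp

lemma closedin_weak_topology_vimage:
  fixes f :: "'v::real_normed_vector \<Rightarrow> real"
  assumes "bounded_linear f" "closed U"
  shows "closedin (weak_topology norm) {x. f x \<in> U}"
  using closedin_continuous_map_preimage[OF continuous_map_weak_topology[OF assms(1)], of U] assms(2)
  by simp

text \<open>
Mazur's theorem: a functional that strictly separates a point from a closed convex set also
  separates a weak neighbourhood of the point from it.
\<close>

lemma closedin_weak_topology_convex:
  fixes S :: "'v::real_normed_vector set"
  assumes "convex S" "closed S"
  shows "closedin (weak_topology norm) S"
proof -
  have "\<exists>T. openin (weak_topology norm) T \<and> z \<in> T \<and> T \<subseteq> - S" if z: "z \<in> - S" for z
  proof -
    obtain f :: "'v \<Rightarrow> real" and \<delta>
      where f: "bounded_linear f" "\<delta> > 0" "\<And>c. c \<in> S \<Longrightarrow> f z + \<delta> \<le> f c"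
      by (rule separate_point_closed_convex[OF assms]) (use z in auto)
    have "openin (weak_topology norm) {x. f x \<in> {..<f z + \<delta>}}"
      by (rule openin_weak_topology_vimage[OF f(1)]) simp
    moreover have "z \<in> {x. f x \<in> {..<f z + \<delta>}}" "{x. f x \<in> {..<f z + \<delta>}} \<subseteq> - S"
      using f(2) by (auto dest: f(3))
    ultimately show ?thesis by blast
  qed
  then have "openin (weak_topology norm) (- S)" by (subst openin_subopen) simp
  then show ?thesis by (simp add: closedin_def Compl_eq_Diff_UNIV)
qed

lemma weak_limit_in_closed_convex:
  fixes S :: "'v::real_normed_vector set"
  assumes "convex S" "closed S" "limitin (weak_topology norm) u l F" "\<forall>\<^sub>F n in F. u n \<in> S" "F \<noteq> bot"
  shows "l \<in> S"
  using limitin_closedin[OF assms(3) closedin_weak_topology_convex[OF assms(1,2)] assms(4,5)] .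

lemma Hausdorff_weak_topology:
  "Hausdorff_space (weak_topology (norm :: 'v::real_normed_vector \<Rightarrow> real))"
  unfolding Hausdorff_space_def
proof (intro allI impI)
  fix x y :: 'v
  assume "x \<in> topspace (weak_topology norm) \<and> y \<in> topspace (weak_topology norm) \<and> x \<noteq> y"
  then have "x - y \<noteq> 0" by simp
  obtain f where f: "bounded_linear f" "\<And>z. \<bar>f z\<bar> \<le> norm z" "f (x - y) = norm (x - y)"
    by (rule norming_functional[of "x - y"]) (rule that)
  then have "f x \<noteq> f y"
    using \<open>x - y \<noteq> 0\<close> linear_diff[OF bounded_linear.linear[OF f(1)], of x y] by auto
  then obtain U V :: "real set" where UV: "open U" "open V" "f x \<in> U" "f y \<in> V" "U \<inter> V = {}"
    using hausdorff[of "f x" "f y"] by blast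
  show "\<exists>U V. openin (weak_topology norm) U \<and> openin (weak_topology norm) V \<and> x \<in> U \<and> y \<in> V \<and> disjnt U V"
    by (rule exI[of _ "{x. f x \<in> U}"], rule exI[of _ "{x. f x \<in> V}"])
       (use UV(3-5) openin_weak_topology_vimage[OF f(1) UV(1)]
        openin_weak_topology_vimage[OF f(1) UV(2)] in \<open>auto simp: disjnt_def\<close>)
qed

lemma weakly_compact_imp_closed:
  fixes C :: "'v::real_normed_vector set"
  assumes "compactin (weak_topology norm) C"
  shows "closed C"
proof -
  have C: "closedin (weak_topology norm) C"
    by (rule compactin_imp_closedin[OF Hausdorff_weak_topology assms])
  show ?thesis unfolding closed_sequential_limits
  proof (intro allI impI, elim conjE)
    fix u l assume u: "\<forall>n. u n \<in> C" "u \<longlonglongrightarrow> l"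
    have "limitin (weak_topology norm) u l sequentially"
      unfolding limitin_weak_topology bounded_functional_norm
    proof (intro allI impI)
      fix f :: "'v \<Rightarrow> real" assume "bounded_linear f"
      then show "(\<lambda>n. f (u n)) \<longlonglongrightarrow> f l" by (rule bounded_linear.tendsto) (rule u(2))
    qed
    then show "l \<in> C" by (rule limitin_closedin[OF _ C]) (simp_all add: u(1))
  qed
qed

text \<open>
The uniform boundedness principle for the points of \<open>C\<close> as functionals on the dual space. Each
  continuous functional is bounded on \<open>C\<close>, so the dual is the union of the closed sets of functionals
  bounded by \<open>n\<close> on \<open>C\<close>. By Baire's theorem one of them contains a ball, and evaluation at norming
  functionals turns this into a bound for the norms.
\<close>

lemma weakly_compact_imp_bounded:
  fixes C :: "'v::real_normed_vector set"
  assumes C: "compactin (weak_topology norm) C"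
  shows "bounded C"
proof -
  define E :: "nat \<Rightarrow> ('v \<Rightarrow>\<^sub>L real) set" where "E n = {f. \<forall>c\<in>C. \<bar>blinfun_apply f c\<bar> \<le> real n}" for n
  have "E n = (\<Inter>c\<in>C. {f. \<bar>blinfun_apply f c\<bar> \<le> real n})" for n by (auto simp: E_def)
  then have closed: "closed (E n)" for n
    by (auto intro!: closed_INT closed_Collect_le continuous_intros)
  have "f \<in> (\<Union>n. E n)" for f
  proof -
    have "compactin euclideanreal (f ` C)"
      by (rule image_compactin[OF C continuous_map_weak_topology]) (rule blinfun.bounded_linear_right)
    then have "bounded (f ` C)" by (simp add: compact_imp_bounded)
    then obtain B where B: "\<And>c. c \<in> C \<Longrightarrow> \<bar>f c\<bar> \<le> B" by (auto simp: bounded_iff)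
    obtain n where "B \<le> real n" using real_arch_simple by blast
    then have "f \<in> E n" unfolding E_def using order_trans[OF B] by simp
    then show ?thesis by blast
  qed
  then have "(\<Union>n. E n) = UNIV" by blast
  then have "interior (\<Union>(range E)) = UNIV" by simp
  moreover have "interior (\<Union>(range E)) = {}" if "\<And>n. interior (E n) = {}"
    using Met_TC.metric_Baire_category_alt[where 'a = "'v \<Rightarrow>\<^sub>L real", of "range E"] that closed
    by (auto simp: complete_UNIV)
  ultimately obtain n f0 where "f0 \<in> interior (E n)" by fastforce
  then obtain r where r: "r > 0" "ball f0 r \<subseteq> E n"
    by (meson interior_subset open_contains_ball open_interior order_trans subsetD)
  have "norm c \<le> 4 * real n / r" if c: "c \<in> C" for c
  proof -
    obtain g where g: "bounded_linear g" "\<And>x. \<bar>g x\<bar> \<le> norm x" "g c = norm c"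
      by (rule norming_functional[of c]) (rule that)
    \<comment> \<open>Scaled so that \<open>f0 + h\<close> stays in the ball around \<open>f0\<close>; then \<open>h\<close> is a difference of two members of \<open>E n\<close>.\<close>
    define h where "h = (r / 2) *\<^sub>R Blinfun g"
    have "norm (Blinfun g) \<le> 1"
      by (rule norm_blinfun_bound) (use g in \<open>auto simp: bounded_linear_Blinfun_apply\<close>)
    then have "norm h < r" using r by (simp add: h_def) 
    then have "f0 + h \<in> E n" "f0 \<in> E n" using r by (auto simp: dist_norm intro!: subsetD[OF r(2)])
    then have "\<bar>f0 c + h c\<bar> \<le> real n" "\<bar>f0 c\<bar> \<le> real n" using c by (auto simp: E_def blinfun.add_left)
    then have "\<bar>h c\<bar> \<le> 2 * real n" by linarith
    moreover have "h c = r / 2 * norm c"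
      using g by (simp add: h_def blinfun.scaleR_left bounded_linear_Blinfun_apply)
    ultimately show ?thesis using r by (simp add: field_simps)
  qed
  then show ?thesis by (auto simp: bounded_iff)
qed

text \<open>
Finite intersection property of the closures of the tails. The index set \<open>J\<close> selects a
  subsequence; it serves to place a cluster point outside a prescribed neighbourhood.
\<close>

lemma compactin_cluster_point:
  fixes v :: "nat \<Rightarrow> 'a"
  assumes C: "compactin X C" and v: "\<And>n. v n \<in> C" and J: "infinite J"
  obtains z where "z \<in> C" "\<And>n. z \<in> X closure_of (v ` (J \<inter> {n..}))"
proof -
  define K where "K n = X closure_of (v ` (J \<inter> {n..}))" for n
  have top: "C \<subseteq> topspace X" using C compactin_subset_topspace by blast
  have "C \<inter> \<Inter>(range K) \<noteq> {}"
  proof (rule compactin_fip[THEN iffD1, OF C, THEN conjunct2, rule_format], intro conjI ballI allI impI)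
    fix T assume "T \<in> range K"
    then show "closedin X T" by (auto simp: K_def)
  next
    fix F assume "finite F \<and> F \<subseteq> range K"
    then obtain I where I: "finite I" "F = K ` I" by (meson finite_subset_image)
    obtain j where j: "j \<in> J" "\<And>i. i \<in> I \<Longrightarrow> i \<le> j"
      using J I(1) by (metis Max_ge finite_nat_set_iff_bounded_le nat_le_linear order_trans)
    have "v j \<in> K i" if "i \<in> I" for i
      unfolding K_def using j that v top by (intro subsetD[OF closure_of_subset]) auto
    then show "C \<inter> \<Inter>F \<noteq> {}" using v I by auto
  qed
  then show ?thesis using that by (auto simp: K_def)
qed

text \<open>
Separability of a union of countably many compact sets, where the dense set need not lie in the
  union.
\<close>

lemma finite_nets_of_compacts:
  fixes D :: "nat \<Rightarrow> 'a::metric_space set"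
  assumes "\<And>n. compact (D n)"
  obtains E where "countable E" "\<And>n x e. x \<in> D n \<Longrightarrow> e > 0 \<Longrightarrow> \<exists>y\<in>E. dist x y < e"
proof -
  have "\<exists>F. finite F \<and> D n \<subseteq> (\<Union>y\<in>F. ball y (1 / real (Suc m)))" for n m
    using assms[of n] compact_eq_totally_bounded[of "D n"] by (metis of_nat_0_less_iff zero_less_Suc zero_less_divide_1_iff)
  then obtain F where F: "\<And>n m. finite (F n m)" "\<And>n m. D n \<subseteq> (\<Union>y\<in>F n m. ball y (1 / real (Suc m)))"
    by metis
  show ?thesis
  proof (rule that[of "\<Union>n m. F n m"])
    show "countable (\<Union>n m. F n m)" using countable_finite[OF F(1)] by blast
    fix n x and e :: real assume x: "x \<in> D n" "e > 0"
    obtain m where m: "1 / real (Suc m) < e" using nat_approx_posE[OF x(2)] by blast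
    obtain y where y: "y \<in> F n m" "x \<in> ball y (1 / real (Suc m))" using F(2)[of n m] x(1) by blast
    then have "dist x y < e" using m by (simp add: dist_commute)
    then show "\<exists>y\<in>\<Union>n m. F n m. dist x y < e" using y(1) by blast
  qed
qed

text \<open>
The sequential half of the Eberlein-Smulian theorem. All weak cluster points of the sequence lie in
  the closed convex hull \<open>V\<close> of its range, which is norm separable. Norming functionals for a countable
  dense set of differences separate the points of \<open>V\<close>. A diagonal subsequence along which these
  countably many functionals converge therefore has only one weak cluster point, and in a weakly
  compact set it converges to it.
\<close>

lemma weakly_compact_imp_weakly_convergent_subsequence:
  fixes u :: "nat \<Rightarrow> 'v::real_normed_vector"
  assumes C: "compactin (weak_topology norm) C" and u: "\<And>n. u n \<in> C"
  obtains r l where "strict_mono r" "l \<in> C" "limitin (weak_topology norm) (u \<circ> r) l sequentially"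
proof -
  let ?X = "weak_topology (norm :: 'v \<Rightarrow> real)"
  define K where "K n = convex hull (u ` {..n})" for n
  have K_mono: "K m \<subseteq> K n" if "m \<le> n" for m n
    unfolding K_def by (rule hull_mono) (use that in auto)
  have K_compact: "compact (K n)" for n
    unfolding K_def by (rule finite_imp_compact_convex_hull) simp
  define V where "V = closure (\<Union>n. K n)"
  have "convex (\<Union>n. K n)"
  proof (rule convexI)
    fix x y and a b :: real
    assume xy: "x \<in> (\<Union>n. K n)" "y \<in> (\<Union>n. K n)" and ab: "0 \<le> a" "0 \<le> b" "a + b = 1"
    from xy obtain m n where "x \<in> K m" "y \<in> K n" by blast
    then have "x \<in> K (max m n)" "y \<in> K (max m n)" using K_mono by (meson max.cobounded1 max.cobounded2 subsetD)+
    then have "a *\<^sub>R x + b *\<^sub>R y \<in> K (max m n)"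
      unfolding K_def by (intro convexD[OF convex_convex_hull] ab)
    then show "a *\<^sub>R x + b *\<^sub>R y \<in> (\<Union>n. K n)" by blast
  qed
  then have V: "closedin ?X V" unfolding V_def by (intro closedin_weak_topology_convex) (auto intro: convex_closure)
  have uV: "u n \<in> V" for n
    unfolding V_def K_def by (intro subsetD[OF closure_subset] UN_I[of n] hull_inc) auto
  \<comment> \<open>The hulls \<open>K n\<close> of finite sets are compact, and their differences are dense in the differences of \<open>V\<close>.\<close>
  define D where "D n = {a - b |a b. a \<in> K n \<and> b \<in> K n}" for n
  have "compact (D n)" for n
    unfolding D_def by (rule compact_differences[OF K_compact K_compact])
  then obtain E where E: "countable E" "\<And>n x e. x \<in> D n \<Longrightarrow> e > 0 \<Longrightarrow> \<exists>y\<in>E. dist x y < e"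
    by (rule finite_nets_of_compacts) (rule that)
  have dense: "\<exists>d\<in>E. dist (a - b) d < e" if ab: "a \<in> V" "b \<in> V" and e: "e > 0" for a b and e :: real
  proof -
    have e3: "e / 3 > 0" using e by simp
    obtain a' m where a': "a' \<in> K m" "dist a' a < e / 3"
      using ab(1) e3 unfolding V_def closure_approachable by blast
    obtain b' n where b': "b' \<in> K n" "dist b' b < e / 3"
      using ab(2) e3 unfolding V_def closure_approachable by blast
    have "a' \<in> K (max m n)" "b' \<in> K (max m n)"
      using a'(1) b'(1) K_mono[of m "max m n"] K_mono[of n "max m n"] by auto
    then have "a' - b' \<in> D (max m n)" unfolding D_def by blast
    then obtain d where d: "d \<in> E" "dist (a' - b') d < e / 3" using E(2)[OF _ e3] by blast
    have "dist (a - b) (a' - b') \<le> dist a' a + dist b' b"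
      unfolding dist_norm by (rule order_trans[OF _ norm_triangle_ineq4]) (simp add: norm_minus_commute algebra_simps)
    then have "dist (a - b) d < e"
      using dist_triangle[of "a - b" d "a' - b'"] a' b' d by linarith
    with d show ?thesis by blast
  qed
  have "E \<noteq> {}" using dense[OF uV uV, of 1] by auto
  define d where "d = from_nat_into E"
  have d: "\<exists>k. d k = y" if "y \<in> E" for y
    using from_nat_into_surj[OF E(1) that] by (auto simp: d_def)
  have "\<exists>f. bounded_linear f \<and> (\<forall>x. \<bar>f x\<bar> \<le> norm x) \<and> f z = norm z" for z :: 'v
    by (rule norming_functional[of z]) blast
  then have "\<exists>g. \<forall>z::'v. bounded_linear (g z) \<and> (\<forall>x. \<bar>g z x\<bar> \<le> norm x) \<and> g z z = norm z"
    by (intro choice allI)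
  then obtain g where g: "\<And>z::'v. bounded_linear (g z)" "\<And>z x. \<bar>g z x\<bar> \<le> norm x" "\<And>z. g z z = norm z"
    by blast
  obtain B where B: "\<And>c. c \<in> C \<Longrightarrow> norm c \<le> B"
    using weakly_compact_imp_bounded[OF C] by (auto simp: bounded_iff)
  \<comment> \<open>Compactness of a countable product of intervals replaces an explicit diagonal argument.\<close>
  define h where "h n = (\<lambda>k. g (d k) (u n))" for n
  have "compact (PiE UNIV (\<lambda>k::nat. {-B..B}))"
    using compactin_PiE[of "\<lambda>_. euclideanreal" "UNIV::nat set" "\<lambda>_. {-B..B}"]
    by (simp add: euclidean_product_topology)
  moreover have "h n \<in> PiE UNIV (\<lambda>k. {-B..B})" for n
    using order_trans[OF g(2) B[OF u]] by (auto simp: h_def abs_le_iff minus_le_iff)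
  ultimately obtain L r where r: "strict_mono r" "(h \<circ> r) \<longlonglongrightarrow> L"
    unfolding compact_eq_seq_compact_metric seq_compact_def by meson
  have hL: "(\<lambda>n. g (d k) (u (r n))) \<longlonglongrightarrow> L k" for k
  proof -
    have "continuous_on UNIV (\<lambda>x :: nat \<Rightarrow> real. x k)" by (rule continuous_on_product_coordinates)
    then have "isCont (\<lambda>x. x k :: real) L"
      using continuous_on_eq_continuous_at[OF open_UNIV] by blast
    then show ?thesis using isCont_tendsto_compose[OF _ r(2)] by (force simp: h_def)
  qed
  have cluster_V: "z \<in> V" and cluster_L: "g (d k) z = L k"
    if z: "\<And>n. z \<in> ?X closure_of ((u \<circ> r) ` (J \<inter> {n..}))" for z k J
  proof -
    show "z \<in> V"
      using closure_of_minimal[OF _ V, of "(u \<circ> r) ` (J \<inter> {0..})"] z[of 0] uV by auto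
    have "dist (g (d k) z) (L k) \<le> e" if e: "e > 0" for e
    proof -
      obtain n where n: "\<And>m. m \<ge> n \<Longrightarrow> dist (g (d k) (u (r m))) (L k) < e"
        using hL[of k] e unfolding lim_sequentially by blast
      have "closedin ?X {x. g (d k) x \<in> cball (L k) e}"
        by (rule closedin_weak_topology_vimage[OF g(1)]) simp
      moreover have "(u \<circ> r) ` (J \<inter> {n..}) \<subseteq> {x. g (d k) x \<in> cball (L k) e}"
        using n by (auto simp: dist_commute less_imp_le)
      ultimately have "z \<in> {x. g (d k) x \<in> cball (L k) e}" using closure_of_minimal z[of n] by blast
      then show ?thesis by (simp add: dist_commute)
    qed
    then show "g (d k) z = L k" by (metis dist_le_zero_iff field_le_epsilon add_0)
  qed
  have unique: "z = z'" if zz: "z \<in> V" "z' \<in> V" "\<And>k. g (d k) z = L k" "\<And>k. g (d k) z' = L k" for z z'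
  proof (rule ccontr)
    assume "z \<noteq> z'"
    then have pos: "norm (z - z') / 2 > 0" by simp
    obtain y where y: "y \<in> E" "dist (z - z') y < norm (z - z') / 2" using dense[OF zz(1,2) pos] by blast
    obtain k where k: "d k = y" using d y by blast
    have "g y (z - z') = 0"
      using zz(3,4)[of k] linear_diff[OF bounded_linear.linear[OF g(1)]] k by simp
    then have "g y (y - (z - z')) = norm y"
      using g(3)[of y] linear_diff[OF bounded_linear.linear[OF g(1)], of y y "z - z'"] by simp
    then have "norm y \<le> norm (y - (z - z'))" using g(2)[of y "y - (z - z')"] by simp
    moreover have "norm (z - z') \<le> norm y + norm (y - (z - z'))"
      using norm_triangle_ineq4[of y "y - (z - z')"] by simp
    ultimately show False using y(2) by (simp add: dist_norm norm_minus_commute)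
  qed
  have ur: "\<And>n. (u \<circ> r) n \<in> C" using u by simp
  obtain l where l: "l \<in> C" "\<And>n. l \<in> ?X closure_of ((u \<circ> r) ` (UNIV \<inter> {n..}))"
    using compactin_cluster_point[of ?X C "u \<circ> r" UNIV, OF C ur] by auto
  have "limitin ?X (u \<circ> r) l sequentially"
    unfolding limitin_def
  proof (intro conjI allI impI)
    fix U assume U: "openin ?X U \<and> l \<in> U"
    show "\<forall>\<^sub>F n in sequentially. (u \<circ> r) n \<in> U"
    proof (rule ccontr)
      assume neg: "\<not> ?thesis"
      \<comment> \<open>The terms outside \<open>U\<close> would have a cluster point outside \<open>U\<close>, contrary to uniqueness.\<close>
      define J where "J = {n. (u \<circ> r) n \<notin> U}"
      have "infinite J"
        using neg by (simp add: J_def eventually_sequentially infinite_nat_iff_unbounded_le)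
      then obtain z where z: "z \<in> C" "\<And>n. z \<in> ?X closure_of ((u \<circ> r) ` (J \<inter> {n..}))"
        using compactin_cluster_point[of ?X C "u \<circ> r" J, OF C ur] by auto
      have "closedin ?X (- U)" using U by (simp add: closedin_def Compl_eq_Diff_UNIV double_diff)
      then have "z \<in> - U"
        using closure_of_minimal[of "(u \<circ> r) ` (J \<inter> {0..})" "- U" ?X] z(2)[of 0] by (auto simp: J_def)
      moreover have "z = l"
        by (rule unique[OF cluster_V[OF z(2)] cluster_V[OF l(2)] cluster_L[OF z(2)] cluster_L[OF l(2)]])
      ultimately show False using U by blast
    qed
  qed simp
  then show ?thesis using that r(1) l(1) by blast
qed

lemma weak_topology_equivalent_norm:
  fixes N :: "'v::real_normed_vector \<Rightarrow> real"
  assumes c: "c > 0" "\<And>x. c * norm x \<le> N x" and K: "\<And>x. N x \<le> K * norm x"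
  shows "weak_topology N = weak_topology norm"
proof -
  have "bounded_functional N f \<longleftrightarrow> bounded_functional norm f" for f
  proof -
    have "\<exists>L. \<forall>x. \<bar>f x\<bar> \<le> L * norm x" if "\<forall>x. \<bar>f x\<bar> \<le> L * N x" for L
    proof (intro exI allI)
      fix x
      have "0 \<le> N x" using c(2)[of x] c(1) by (meson mult_nonneg_nonneg norm_ge_zero order_trans less_imp_le)
      have "\<bar>f x\<bar> \<le> \<bar>L\<bar> * N x" using that \<open>0 \<le> N x\<close> by (meson abs_ge_self mult_right_mono order_trans)
      also have "\<dots> \<le> \<bar>L\<bar> * (K * norm x)" by (intro mult_left_mono K) simp
      finally show "\<bar>f x\<bar> \<le> (\<bar>L\<bar> * K) * norm x" by simp
    qed
    moreover have "\<exists>L. \<forall>x. \<bar>f x\<bar> \<le> L * N x" if "\<forall>x. \<bar>f x\<bar> \<le> L * norm x" for L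
    proof (intro exI allI)
      fix x
      have "\<bar>f x\<bar> \<le> \<bar>L\<bar> * norm x" using that by (meson abs_ge_self mult_right_mono norm_ge_zero order_trans)
      also have "\<dots> \<le> \<bar>L\<bar> * (N x / c)" using c by (intro mult_left_mono) (auto simp: field_simps)
      finally show "\<bar>f x\<bar> \<le> (\<bar>L\<bar> / c) * N x" by simp
    qed
    ultimately show ?thesis unfolding bounded_functional_def by blast
  qed
  then show ?thesis by (simp add: weak_topology_def)
qed

lemma limitin_weak_topology_bounded_linear:
  fixes A :: "'v::real_normed_vector \<Rightarrow> 'w::real_normed_vector"
  assumes "limitin (weak_topology norm) w l F" and A: "bounded_linear A"
  shows "limitin (weak_topology norm) (\<lambda>n. A (w n)) (A l) F"
  unfolding limitin_weak_topology bounded_functional_norm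
proof (intro allI impI)
  fix f :: "'w \<Rightarrow> real" assume "bounded_linear f"
  then have "bounded_linear (\<lambda>x. f (A x))" by (rule bounded_linear_compose[OF _ A])
  then show "((\<lambda>n. f (A (w n))) \<longlongrightarrow> f (A l)) F"
    using assms(1)[unfolded limitin_weak_topology bounded_functional_norm, rule_format, of "\<lambda>x. f (A x)"]
    by simp
qed

lemma continuous_map_weak_topology_bounded_linear:
  fixes A :: "'v::real_normed_vector \<Rightarrow> 'w::real_normed_vector"
  assumes A: "bounded_linear A"
  shows "continuous_map (weak_topology norm) (weak_topology norm) A"
proof -
  let ?B = "{f -` U |(f :: 'w \<Rightarrow> real) U. bounded_functional norm f \<and> open U}"
  have "continuous_map (weak_topology norm) (topology_generated_by ?B) A"
  proof (rule continuous_on_generated_topo)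
    fix W assume "W \<in> ?B"
    then obtain f :: "'w \<Rightarrow> real" and U where W: "W = f -` U" "bounded_linear f" "open U"
      by (auto simp: bounded_functional_norm)
    have "openin (weak_topology norm) {x. f (A x) \<in> U}"
      by (rule openin_weak_topology_vimage[OF bounded_linear_compose[OF W(2) A] W(3)])
    then show "openin (weak_topology norm) (A -` W \<inter> topspace (weak_topology norm))"
      by (simp add: W(1) vimage_def)
  next
    have "\<Union>?B = UNIV"
      using topspace_weak_topology[of "norm :: 'w \<Rightarrow> real"]
      unfolding weak_topology_def topology_generated_by_topspace .
    then show "A ` topspace (weak_topology norm) \<subseteq> \<Union>?B" by simp
  qed
  then show ?thesis by (simp only: weak_topology_def)
qed

lemma limitin_weak_topology_diff_const:
  fixes l :: "'v::real_normed_vector"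
  assumes "limitin (weak_topology norm) w l F"
  shows "limitin (weak_topology norm) (\<lambda>n. w n - a) (l - a) F"
  unfolding limitin_weak_topology bounded_functional_norm
proof (intro allI impI)
  fix f :: "'v \<Rightarrow> real" assume f: "bounded_linear f"
  then have "((\<lambda>n. f (w n)) \<longlongrightarrow> f l) F"
    using assms unfolding limitin_weak_topology bounded_functional_norm by simp
  then have "((\<lambda>n. f (w n) - f a) \<longlongrightarrow> f l - f a) F" by (intro tendsto_diff tendsto_const)
  then show "((\<lambda>n. f (w n - a)) \<longlongrightarrow> f (l - a)) F"
    by (simp add: linear_diff[OF bounded_linear.linear[OF f]])
qed

text \<open>
Weak lower semicontinuity of the norm, in the form needed for translates of a weakly null
  sequence: a norming functional for \<open>v\<close> tends to \<open>norm v\<close> along \<open>v - x n\<close>.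
\<close>

lemma weakly_null_norm_diff:
  fixes x :: "nat \<Rightarrow> 'v::real_normed_vector"
  assumes x: "limitin (weak_topology norm) x 0 sequentially" and e: "e > 0"
  shows "\<forall>\<^sub>F n in sequentially. norm v < norm (x n - v) + e"
proof -
  obtain f where f: "bounded_linear f" "\<And>x. \<bar>f x\<bar> \<le> norm x" "f v = norm v"
    by (rule norming_functional[of v]) (rule that)
  note lin = bounded_linear.linear[OF f(1)]
  have "(\<lambda>n. f (x n)) \<longlonglongrightarrow> 0"
    using x f(1) linear_0[OF lin] unfolding limitin_weak_topology bounded_functional_norm by metis
  then have "\<forall>\<^sub>F n in sequentially. f (x n) < e" using e by (rule order_tendstoD)
  then show ?thesis
  proof eventually_elim
    case (elim n)
    have "f (x n - v) = f (x n) - norm v" using linear_diff[OF lin] f(3) by simp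
    then show ?case using f(2)[of "x n - v"] elim by simp
  qed
qed

section \<open>Minimal invariant sets of nonexpansive maps\<close>

text \<open>
The direct sum norm depends on a parameter and is not the type-class norm of the product, but it is
  equivalent to it. Topological notions (closed, bounded, weak convergence) refer to the type-class
  norm, metric ones to \<open>N\<close>.
\<close>

locale equivalent_norm =
  fixes N :: "'v::real_normed_vector \<Rightarrow> real" and c K :: real
  assumes is_norm: "is_norm N"
    and c_pos: "c > 0"
    and lower: "c * norm x \<le> N x"
    and upper: "N x \<le> K * norm x"
begin

lemma N_scale: "N (a *\<^sub>R x) = \<bar>a\<bar> * N x"
  and N_triangle: "N (x + y) \<le> N x + N y"
  and N_zero: "N 0 = 0"
  using is_norm by (auto simp: is_norm_def)

lemma N_ge_0: "0 \<le> N x"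
  using lower[of x] c_pos by (meson less_imp_le mult_nonneg_nonneg norm_ge_zero order_trans)

lemma N_minus: "N (- x) = N x"
  using N_scale[of "- 1" x] by simp

lemma N_diff_commute: "N (x - y) = N (y - x)"
  using N_minus[of "x - y"] by simp

lemma N_diff_triangle: "N (x - z) \<le> N (x - y) + N (y - z)"
  using N_triangle[of "x - y" "y - z"] by simp

lemma N_convex_combination:
  assumes "0 \<le> a" "0 \<le> b"
  shows "N (a *\<^sub>R x + b *\<^sub>R y) \<le> a * N x + b * N y"
  using N_triangle[of "a *\<^sub>R x" "b *\<^sub>R y"] assms by (simp add: N_scale)

lemma N_lipschitz: "\<bar>N x - N y\<bar> \<le> K * norm (x - y)"
proof -
  have "N x \<le> N (x - y) + N y" "N y \<le> N (y - x) + N x"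
    using N_triangle[of "x - y" y] N_triangle[of "y - x" x] by simp_all
  then show ?thesis using upper[of "x - y"] N_diff_commute[of x y] by linarith
qed

lemma N_diff_tendsto: "u \<longlonglongrightarrow> l \<Longrightarrow> (\<lambda>n. N (u n - a)) \<longlonglongrightarrow> N (l - a)"
proof -
  assume "u \<longlonglongrightarrow> l"
  then have "(\<lambda>n. K * norm (u n - l)) \<longlonglongrightarrow> 0"
    by (intro tendsto_mult_right_zero tendsto_norm_zero LIM_zero)
  moreover have "\<forall>\<^sub>F n in sequentially. norm (N (u n - a) - N (l - a)) \<le> K * norm (u n - l)"
    using N_lipschitz[of "u _ - a" "l - a"] by (simp add: always_eventually)
  ultimately show ?thesis by (rule LIM_zero_cancel[OF Lim_null_comparison, rotated])
qed

lemma convex_N_ball: "convex {u. N (u - a) \<le> r}"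
proof (rule convexI)
  fix x y and s t :: real
  assume xy: "x \<in> {u. N (u - a) \<le> r}" "y \<in> {u. N (u - a) \<le> r}" and st: "0 \<le> s" "0 \<le> t" "s + t = 1"
  have "(s *\<^sub>R x + t *\<^sub>R y) - a = s *\<^sub>R (x - a) + t *\<^sub>R (y - a)"
    using st(3) by (simp add: algebra_simps flip: scaleR_add_left)
  then have "N ((s *\<^sub>R x + t *\<^sub>R y) - a) \<le> s * N (x - a) + t * N (y - a)"
    using N_convex_combination[OF st(1,2), of "x - a" "y - a"] by simp
  also have "\<dots> \<le> r" using convex_bound_le[of "N (x - a)" r "N (y - a)" s t] xy st by simp
  finally show "s *\<^sub>R x + t *\<^sub>R y \<in> {u. N (u - a) \<le> r}" by simp
qed

lemma closed_N_ball: "closed {u. N (u - a) \<le> r}"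
  unfolding closed_sequential_limits
  by (auto intro: LIMSEQ_le_const2[OF N_diff_tendsto])

lemma N_ball_weak_limit:
  assumes "limitin (weak_topology norm) w l sequentially" "\<forall>\<^sub>F n in sequentially. N (w n - a) \<le> r"
  shows "N (l - a) \<le> r"
  using weak_limit_in_closed_convex[OF convex_N_ball closed_N_ball assms(1), of a r] assms(2) by simp

end

definition minimal_invariant :: "('v::real_normed_vector \<Rightarrow> 'v) \<Rightarrow> 'v set \<Rightarrow> bool" where
  "minimal_invariant T C \<longleftrightarrow> C \<noteq> {} \<and> closed C \<and> convex C \<and> T ` C \<subseteq> C \<and>
     (\<forall>D. D \<noteq> {} \<and> closed D \<and> convex D \<and> T ` D \<subseteq> D \<and> D \<subseteq> C \<longrightarrow> D = C)"

lemma minimal_invariantD: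
  assumes "minimal_invariant T C"
  shows "C \<noteq> {}" "closed C" "convex C" "u \<in> C \<Longrightarrow> T u \<in> C"
  using assms by (auto simp: minimal_invariant_def)

lemma minimal_invariant_eq:
  assumes "minimal_invariant T C" "D \<subseteq> C" "D \<noteq> {}" "closed D" "convex D" "\<And>u. u \<in> D \<Longrightarrow> T u \<in> D"
  shows "D = C"
  using assms unfolding minimal_invariant_def by (metis image_subsetI)

text \<open>
Closed convex subsets are weakly closed, so weak compactness makes the intersection of a chain
  nonempty and Zorn's lemma applies.
\<close>

lemma exists_minimal_invariant:
  fixes C :: "'v::real_normed_vector set"
  assumes C: "compactin (weak_topology norm) C" "convex C" "C \<noteq> {}" and T: "T ` C \<subseteq> C"
  obtains D where "D \<subseteq> C" "minimal_invariant T D"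
proof -
  define A where "A = {D. D \<noteq> {} \<and> closed D \<and> convex D \<and> T ` D \<subseteq> D \<and> D \<subseteq> C}"
  have CA: "C \<in> A" using C T weakly_compact_imp_closed[OF C(1)] by (auto simp: A_def)
  have "\<exists>m\<in>A. \<forall>a\<in>A. a \<subseteq> m \<longrightarrow> a = m"
  proof (rule predicate_Zorn)
    show "partial_order_on A (relation_of (\<lambda>a b. b \<subseteq> a) A)"
      by (rule partial_order_on_relation_ofI) auto
  next
    fix \<C> assume "\<C> \<in> Chains (relation_of (\<lambda>a b. b \<subseteq> a) A)"
    then have CA': "\<And>D. D \<in> \<C> \<Longrightarrow> D \<in> A"
      and chain: "\<And>D E. D \<in> \<C> \<Longrightarrow> E \<in> \<C> \<Longrightarrow> D \<subseteq> E \<or> E \<subseteq> D"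
      unfolding Chains_def relation_of_def by auto
    show "\<exists>u\<in>A. \<forall>a\<in>\<C>. u \<subseteq> a"
    proof (cases "\<C> = {}")
      case True
      then show ?thesis using CA by auto
    next
      case False
      have fin: "\<exists>D\<in>\<C>. D \<subseteq> \<Inter>F" if "finite F" "F \<subseteq> \<C>" "F \<noteq> {}" for F
        using that(1,3,2)
      proof (induction F rule: finite_ne_induct)
        case (insert x F)
        then obtain D where D: "D \<in> \<C>" "D \<subseteq> \<Inter>F" by auto
        have x: "x \<in> \<C>" using insert.prems by simp
        from chain[OF x D(1)] show ?case
        proof
          assume "x \<subseteq> D"
          with D x show ?case by (intro bexI[of _ x]) auto
        next
          assume "D \<subseteq> x"
          with D show ?case by (intro bexI[of _ D]) auto
        qed
      qed auto
      have "C \<inter> \<Inter>\<C> \<noteq> {}"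
      proof (rule compactin_fip[THEN iffD1, OF C(1), THEN conjunct2, rule_format], intro conjI ballI allI impI)
        fix D assume "D \<in> \<C>"
        then show "closedin (weak_topology norm) D"
          using CA' closedin_weak_topology_convex by (auto simp: A_def)
      next
        fix F assume F: "finite F \<and> F \<subseteq> \<C>"
        show "C \<inter> \<Inter>F \<noteq> {}"
        proof (cases "F = {}")
          case False
          then obtain D where "D \<in> \<C>" "D \<subseteq> \<Inter>F" using fin F by blast
          moreover have "D \<noteq> {}" "D \<subseteq> C" using CA'[OF \<open>D \<in> \<C>\<close>] by (auto simp: A_def)
          ultimately show ?thesis by blast
        qed (use C in simp)
      qed
      moreover have "\<Inter>\<C> \<subseteq> C" using False CA' by (auto simp: A_def)
      moreover have "closed (\<Inter>\<C>)" using CA' by (auto simp: A_def intro: closed_Inter)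
      moreover have "convex (\<Inter>\<C>)" using CA' by (auto simp: A_def intro: convex_Inter)
      moreover have "T ` \<Inter>\<C> \<subseteq> \<Inter>\<C>" using CA' unfolding A_def by blast
      ultimately have "\<Inter>\<C> \<in> A" by (auto simp: A_def)
      then show ?thesis by blast
    qed
  qed
  then obtain m where m: "m \<in> A" "\<And>a. a \<in> A \<Longrightarrow> a \<subseteq> m \<Longrightarrow> a = m" by blast
  have "minimal_invariant T m"
    unfolding minimal_invariant_def
  proof (intro conjI allI impI)
    fix D assume D: "D \<noteq> {} \<and> closed D \<and> convex D \<and> T ` D \<subseteq> D \<and> D \<subseteq> m"
    then have "D \<in> A" using m(1) unfolding A_def by blast
    then show "D = m" using m(2) D by blast
  qed (use m(1) in \<open>unfold A_def, blast+\<close>)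
  then show ?thesis using that m(1) by (auto simp: A_def)
qed

context equivalent_norm
begin

text \<open>
The strict contraction \<open>(1 - t) *\<^sub>R T u + t *\<^sub>R x0\<close> moves its own iterates by at most
  \<open>(1 - t) ^ k * B\<close>, and for small \<open>t\<close> it is uniformly close to \<open>T\<close>.
\<close>

lemma exists_approximate_fixed_point:
  assumes C: "convex C" "x0 \<in> C" and T: "\<And>u. u \<in> C \<Longrightarrow> T u \<in> C" "nonexpansive_on N C T"
    and B: "\<And>x y. x \<in> C \<Longrightarrow> y \<in> C \<Longrightarrow> N (x - y) \<le> B" and e: "e > 0"
  obtains u where "u \<in> C" "N (T u - u) < e"
proof -
  have B0: "0 \<le> B" using B[OF C(2) C(2)] N_zero by simp
  \<comment> \<open>This choice gives \<open>t * B \<le> e / 2\<close>, half of the admissible error.\<close>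
  define t where "t = min 1 (e / (2 * (B + 1)))"
  have t: "0 < t" "t \<le> 1" using e B0 by (auto simp: t_def)
  have "t * (B + 1) \<le> e / (2 * (B + 1)) * (B + 1)"
    unfolding t_def using B0 by (intro mult_right_mono) auto
  also have "\<dots> = e / 2" using B0 by (simp add: field_simps)
  finally have tB: "t * B \<le> e / 2" using t by (simp add: distrib_left)
  define S where "S u = (1 - t) *\<^sub>R T u + t *\<^sub>R x0" for u
  have SC: "S u \<in> C" if "u \<in> C" for u
    unfolding S_def using t that T C by (intro convexD) auto
  have S_contr: "N (S u - S v) \<le> (1 - t) * N (u - v)" if "u \<in> C" "v \<in> C" for u v
  proof -
    have "S u - S v = (1 - t) *\<^sub>R (T u - T v)" by (simp add: S_def scaleR_diff_right)
    then show ?thesis using that T(2) t by (simp add: N_scale nonexpansive_on_def mult_left_mono)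
  qed
  have iter_C: "(S ^^ k) x0 \<in> C" for k by (induction k) (use C SC in auto)
  have step: "N ((S ^^ Suc k) x0 - (S ^^ k) x0) \<le> (1 - t) ^ k * B" for k
  proof (induction k)
    case 0
    show ?case using B[OF SC[OF C(2)] C(2)] by simp
  next
    case (Suc k)
    have "N ((S ^^ Suc (Suc k)) x0 - (S ^^ Suc k) x0) \<le> (1 - t) * N ((S ^^ Suc k) x0 - (S ^^ k) x0)"
      using S_contr[OF iter_C iter_C, of "Suc k" k] by simp
    also have "\<dots> \<le> (1 - t) * ((1 - t) ^ k * B)" using Suc t by (intro mult_left_mono) auto
    finally show ?case by simp
  qed
  have "(\<lambda>k. (1 - t) ^ k * B) \<longlonglongrightarrow> 0"
    using t by (intro tendsto_mult_left_zero LIMSEQ_power_zero) auto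
  then have "\<forall>\<^sub>F k in sequentially. (1 - t) ^ k * B < e / 2"
    using e by (intro order_tendstoD) auto
  then obtain k where "(1 - t) ^ k * B < e / 2" by (auto simp: eventually_sequentially)
  then have k: "N (S ((S ^^ k) x0) - (S ^^ k) x0) < e / 2"
    using step[of k] by simp
  define u where "u = (S ^^ k) x0"
  have u: "u \<in> C" using iter_C by (simp add: u_def)
  have "T u - S u = t *\<^sub>R (T u - x0)" by (simp add: S_def algebra_simps)
  then have "N (T u - S u) \<le> t * B" using B[OF T(1)[OF u] C(2)] t by (simp add: N_scale mult_left_mono)
  then have "N (T u - u) < e" using N_diff_triangle[of "T u" u "S u"] k tB by (simp add: u_def)
  with u show ?thesis by (rule that)
qed

text \<open>
The limit \<open>d\<close> is the diameter of \<open>C\<close>. If \<open>N (w n - u) \<le> e < d\<close> along a subsequence, then the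
  points with this asymptotic bound for all \<open>e + \<epsilon>\<close> form a closed convex \<open>T\<close>-invariant set, which is
  \<open>C\<close> by minimality. By weak lower semicontinuity the weak limit \<open>l\<close> is within \<open>e\<close> of every point of
  \<open>C\<close>. The set of all points with that property is again closed, convex and invariant, hence equal
  to \<open>C\<close>, and the diameter is at most \<open>e\<close>, a contradiction.
\<close>

lemma goebel_karlovitz:
  assumes C: "minimal_invariant T C" and T: "nonexpansive_on N C T" and bd: "bounded C"
    and w: "\<And>n. w n \<in> C" "(\<lambda>n. N (T (w n) - w n)) \<longlonglongrightarrow> 0"
      "limitin (weak_topology norm) w l sequentially" "l \<in> C"
  obtains d where "\<And>u. u \<in> C \<Longrightarrow> (\<lambda>n. N (w n - u)) \<longlonglongrightarrow> d"
proof -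
  note Cprops = minimal_invariantD[OF C]
  obtain R where R: "\<And>x. x \<in> C \<Longrightarrow> norm x \<le> R" using bd by (auto simp: bounded_iff)
  define d where "d = (SUP p\<in>C \<times> C. N (fst p - snd p))"
  have "N (fst p - snd p) \<le> \<bar>K\<bar> * (2 * R)" if "p \<in> C \<times> C" for p
  proof -
    have "norm (fst p - snd p) \<le> 2 * R"
      using norm_triangle_ineq4[of "fst p" "snd p"] R[of "fst p"] R[of "snd p"] that by auto
    then have "\<bar>K\<bar> * norm (fst p - snd p) \<le> \<bar>K\<bar> * (2 * R)" by (intro mult_left_mono) auto
    moreover have "K * norm (fst p - snd p) \<le> \<bar>K\<bar> * norm (fst p - snd p)" by (intro mult_right_mono) auto
    ultimately show ?thesis using upper[of "fst p - snd p"] by linarith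
  qed
  then have bdd: "bdd_above ((\<lambda>p. N (fst p - snd p)) ` (C \<times> C))" by (intro bdd_aboveI2)
  have le_d: "N (x - y) \<le> d" if "x \<in> C" "y \<in> C" for x y
    unfolding d_def using cSUP_upper[OF _ bdd, of "(x, y)"] that by simp
  have d_le: "d \<le> e" if "\<And>x y. x \<in> C \<Longrightarrow> y \<in> C \<Longrightarrow> N (x - y) \<le> e" for e
    unfolding d_def by (rule cSUP_least) (use that w(4) in auto)
  have ev: "\<forall>\<^sub>F n in sequentially. e < N (w n - u)" if u: "u \<in> C" and e: "e < d" for u e
  proof (rule ccontr)
    assume "\<not> ?thesis"
    then have freq: "\<exists>\<^sub>F n in sequentially. N (w n - u) \<le> e" by (simp add: not_eventually not_less)
    then have "infinite {n. N (w n - u) \<le> e}"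
      by (simp add: frequently_cofinite flip: cofinite_eq_sequentially)
    then obtain s :: "nat \<Rightarrow> nat" where s: "strict_mono s" "\<And>n. N (w (s n) - u) \<le> e"
      using infinite_enumerate by blast
    \<comment> \<open>The margin \<open>\<epsilon>\<close> makes \<open>Q\<close> closed and stable under \<open>T\<close>, which moves \<open>w (s n)\<close> slightly.\<close>
    define Q where "Q = {x \<in> C. \<forall>\<epsilon>>0. \<forall>\<^sub>F n in sequentially. N (w (s n) - x) \<le> e + \<epsilon>}"
    have ws: "(\<lambda>n. N (T (w (s n)) - w (s n))) \<longlonglongrightarrow> 0"
      using LIMSEQ_subseq_LIMSEQ[OF w(2) s(1)] by (simp add: o_def)
    have "Q = C"
    proof (rule minimal_invariant_eq[OF C])
      show "Q \<subseteq> C" by (auto simp: Q_def)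
      have "u \<in> Q" using s(2) u by (auto simp: Q_def intro!: always_eventually add_increasing2)
      then show "Q \<noteq> {}" by blast
      show "closed Q" unfolding closed_sequential_limits
      proof (intro allI impI, elim conjE)
        fix x y assume x: "\<forall>n. x n \<in> Q" "x \<longlonglongrightarrow> y"
        have "y \<in> C" using x Cprops(2) unfolding closed_sequential_limits Q_def by blast
        moreover have "\<forall>\<^sub>F n in sequentially. N (w (s n) - y) \<le> e + \<epsilon>" if \<epsilon>: "\<epsilon> > 0" for \<epsilon>
        proof -
          have "\<forall>\<^sub>F k in sequentially. N (x k - y) < \<epsilon> / 2"
            using order_tendstoD(2)[OF N_diff_tendsto[OF x(2), of y], of "\<epsilon> / 2"] \<epsilon> by (simp add: N_zero)
          then obtain k where k: "N (x k - y) < \<epsilon> / 2" by (auto simp: eventually_sequentially)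
          have "\<forall>\<^sub>F n in sequentially. N (w (s n) - x k) \<le> e + \<epsilon> / 2"
            using x(1) \<epsilon> by (simp add: Q_def)
          then show ?thesis
          proof eventually_elim
            case (elim n)
            then show ?case using N_diff_triangle[of "w (s n)" y "x k"] k by linarith
          qed
        qed
        ultimately show "y \<in> Q" by (simp add: Q_def)
      qed
      show "convex Q"
      proof (rule convexI)
        fix x y and a b :: real
        assume xy: "x \<in> Q" "y \<in> Q" and ab: "0 \<le> a" "0 \<le> b" "a + b = 1"
        have "\<forall>\<^sub>F n in sequentially. N (w (s n) - (a *\<^sub>R x + b *\<^sub>R y)) \<le> e + \<epsilon>" if \<epsilon>: "\<epsilon> > 0" for \<epsilon>
        proof -
          have "\<forall>\<^sub>F n in sequentially. N (w (s n) - x) \<le> e + \<epsilon>" "\<forall>\<^sub>F n in sequentially. N (w (s n) - y) \<le> e + \<epsilon>"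
            using xy \<epsilon> by (auto simp: Q_def)
          then show ?thesis
          proof eventually_elim
            case (elim n)
            then have "x \<in> {v. N (v - w (s n)) \<le> e + \<epsilon>}" "y \<in> {v. N (v - w (s n)) \<le> e + \<epsilon>}"
              by (auto simp: N_diff_commute)
            then have "a *\<^sub>R x + b *\<^sub>R y \<in> {v. N (v - w (s n)) \<le> e + \<epsilon>}"
              by (intro convexD[OF convex_N_ball] ab)
            then show ?case by (simp add: N_diff_commute)
          qed
        qed
        moreover have "a *\<^sub>R x + b *\<^sub>R y \<in> C" using xy ab Cprops(3) by (auto simp: Q_def intro: convexD)
        ultimately show "a *\<^sub>R x + b *\<^sub>R y \<in> Q" by (simp add: Q_def)
      qed
      fix x assume x: "x \<in> Q"
      have "\<forall>\<^sub>F n in sequentially. N (w (s n) - T x) \<le> e + \<epsilon>" if \<epsilon>: "\<epsilon> > 0" for \<epsilon>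
      proof -
        have "\<forall>\<^sub>F n in sequentially. N (w (s n) - x) \<le> e + \<epsilon> / 2" using x \<epsilon> by (simp add: Q_def)
        moreover have "\<forall>\<^sub>F n in sequentially. N (T (w (s n)) - w (s n)) < \<epsilon> / 2"
          using order_tendstoD(2)[OF ws, of "\<epsilon> / 2"] \<epsilon> by simp
        ultimately show ?thesis
        proof eventually_elim
          case (elim n)
          have "N (T (w (s n)) - T x) \<le> N (w (s n) - x)"
            using T w(1) x unfolding nonexpansive_on_def Q_def by blast
          then show ?case
            using N_diff_triangle[of "w (s n)" "T x" "T (w (s n))"] elim
            by (simp add: N_diff_commute[of "w (s n)" "T (w (s n))"])
        qed
      qed
      then show "T x \<in> Q" using x Cprops(4) by (simp add: Q_def)
    qed
    have l_le: "N (l - x) \<le> e" if x: "x \<in> C" for x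
    proof (rule field_le_epsilon)
      fix \<epsilon> :: real assume "\<epsilon> > 0"
      then have "\<forall>\<^sub>F n in sequentially. N ((w \<circ> s) n - x) \<le> e + \<epsilon>"
        using x \<open>Q = C\<close> by (auto simp: Q_def)
      moreover have "limitin (weak_topology norm) (w \<circ> s) l sequentially"
        by (rule limitin_subsequence[OF s(1) w(3)])
      ultimately show "N (l - x) \<le> e + \<epsilon>" by (intro N_ball_weak_limit)
    qed
    define P where "P = {y \<in> C. \<forall>x\<in>C. N (y - x) \<le> e}"
    have "P = C"
    proof (rule minimal_invariant_eq[OF C])
      show "P \<subseteq> C" by (auto simp: P_def)
      show "P \<noteq> {}" using l_le w(4) by (auto simp: P_def)
      have P: "P = C \<inter> (\<Inter>x\<in>C. {y. N (y - x) \<le> e})" by (auto simp: P_def)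
      show "closed P" unfolding P using Cprops(2) closed_N_ball by (intro closed_Int closed_INT) auto
      show "convex P" unfolding P using Cprops(3) convex_N_ball by (intro convex_Int convex_INT) auto
      fix y assume y: "y \<in> P"
      then have yC: "y \<in> C" by (simp add: P_def)
      \<comment> \<open>The bound for \<open>y\<close> passes to \<open>T y\<close> only on \<open>T ` C\<close>; minimality extends it to \<open>C\<close>.\<close>
      have "C \<inter> {x. N (x - T y) \<le> e} = C"
      proof (rule minimal_invariant_eq[OF C])
        have TT: "N (T x - T y) \<le> e" if "x \<in> C" for x
        proof -
          have "N (T x - T y) \<le> N (x - y)" using T that yC by (auto simp: nonexpansive_on_def)
          also have "\<dots> \<le> e" using y that by (simp add: P_def N_diff_commute)
          finally show ?thesis .
        qed
        show "C \<inter> {x. N (x - T y) \<le> e} \<noteq> {}" using TT[OF yC] Cprops(4)[OF yC] by blast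
        show "T x \<in> C \<inter> {x. N (x - T y) \<le> e}" if "x \<in> C \<inter> {x. N (x - T y) \<le> e}" for x
          using that TT Cprops(4) by blast
      qed (use Cprops(2,3) closed_N_ball convex_N_ball in \<open>auto intro: closed_Int convex_Int\<close>)
      then have "N (x - T y) \<le> e" if "x \<in> C" for x using that by blast
      then show "T y \<in> P" using Cprops(4)[OF yC] by (simp add: P_def N_diff_commute)
    qed
    then have "d \<le> e" by (intro d_le) (auto simp: P_def)
    then show False using e by simp
  qed
  have "(\<lambda>n. N (w n - u)) \<longlonglongrightarrow> d" if u: "u \<in> C" for u
  proof (rule order_tendstoI)
    show "\<forall>\<^sub>F n in sequentially. N (w n - u) < a" if "d < a" for a
      using le_d[OF w(1) u] that by (intro always_eventually allI) (rule order_le_less_trans)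
  qed (use ev u in blast)
  then show ?thesis using that by blast
qed

text \<open>
To locate a minimal set it suffices to control the images of one point under all nonexpansive
  self-maps \<open>S\<close> that share the approximate fixed point sequence \<open>w\<close>. These maps are closed under
  \<open>S \<mapsto> T \<circ> S\<close> and under convex combinations and contain the identity, so the images of \<open>l\<close> form a
  convex set that \<open>T\<close> maps into itself. This lets a single map \<open>S\<close> replace all iterated applications
  of \<open>T\<close> and convex combinations that would generate \<open>C\<close> from \<open>l\<close>.
\<close>

lemma minimal_set_in_closure_of_orbit:
  assumes C: "minimal_invariant T C" and T: "nonexpansive_on N C T"
    and w: "\<And>n. w n \<in> C" "(\<lambda>n. N (T (w n) - w n)) \<longlonglongrightarrow> 0" and l: "l \<in> C"
    and F: "closed F" "\<And>S. \<lbrakk>\<And>u. u \<in> C \<Longrightarrow> S u \<in> C; nonexpansive_on N C S;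
                       (\<lambda>n. N (S (w n) - w n)) \<longlonglongrightarrow> 0\<rbrakk> \<Longrightarrow> S l \<in> F"
  shows "C \<subseteq> F"
proof -
  note Cprops = minimal_invariantD[OF C]
  define good where "good S \<longleftrightarrow> (\<forall>u\<in>C. S u \<in> C) \<and> nonexpansive_on N C S \<and>
    (\<lambda>n. N (S (w n) - w n)) \<longlonglongrightarrow> 0" for S
  have good_id: "good (\<lambda>x. x)" by (simp add: good_def nonexpansive_on_def N_zero)
  have good_T: "good (\<lambda>x. T (S x))" if S: "good S" for S
  proof -
    have S': "\<And>u. u \<in> C \<Longrightarrow> S u \<in> C" "nonexpansive_on N C S" "(\<lambda>n. N (S (w n) - w n)) \<longlonglongrightarrow> 0"
      using S by (auto simp: good_def)
    have "N (T (S x) - T (S y)) \<le> N (x - y)" if "x \<in> C" "y \<in> C" for x y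
      using T S'(1)[OF that(1)] S'(1)[OF that(2)] S'(2) that unfolding nonexpansive_on_def
      by (meson order_trans)
    moreover have "(\<lambda>n. N (T (S (w n)) - w n)) \<longlonglongrightarrow> 0"
    proof (rule tendsto_sandwich[OF _ _ tendsto_const])
      show "(\<lambda>n. N (S (w n) - w n) + N (T (w n) - w n)) \<longlonglongrightarrow> 0"
        using tendsto_add[OF S'(3) w(2)] by simp
      have "N (T (S (w n)) - w n) \<le> N (S (w n) - w n) + N (T (w n) - w n)" for n
      proof -
        have "N (T (S (w n)) - T (w n)) \<le> N (S (w n) - w n)"
          using T S'(1) w(1) by (auto simp: nonexpansive_on_def)
        then show ?thesis using N_diff_triangle[of "T (S (w n))" "w n" "T (w n)"] by linarith
      qed
      then show "\<forall>\<^sub>F n in sequentially. N (T (S (w n)) - w n) \<le> N (S (w n) - w n) + N (T (w n) - w n)"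
        by simp
    qed (simp add: N_ge_0)
    ultimately show ?thesis using S'(1) Cprops(4) by (auto simp: good_def nonexpansive_on_def)
  qed
  have good_convex: "good (\<lambda>x. a *\<^sub>R S x + b *\<^sub>R S' x)"
    if S: "good S" "good S'" and ab: "0 \<le> a" "0 \<le> b" "a + b = 1" for S S' and a b :: real
  proof -
    have split: "(a *\<^sub>R x + b *\<^sub>R y) - z = a *\<^sub>R (x - z) + b *\<^sub>R (y - z)" for x y z :: 'v
      using ab(3) by (simp add: algebra_simps flip: scaleR_add_left)
    have "N ((a *\<^sub>R S x + b *\<^sub>R S' x) - (a *\<^sub>R S y + b *\<^sub>R S' y)) \<le> N (x - y)"
      if "x \<in> C" "y \<in> C" for x y
    proof -
      have "(a *\<^sub>R S x + b *\<^sub>R S' x) - (a *\<^sub>R S y + b *\<^sub>R S' y) = a *\<^sub>R (S x - S y) + b *\<^sub>R (S' x - S' y)"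
        by (simp add: algebra_simps)
      also have "N \<dots> \<le> a * N (S x - S y) + b * N (S' x - S' y)"
        by (rule N_convex_combination[OF ab(1,2)])
      also have "\<dots> \<le> N (x - y)"
        using S that convex_bound_le[OF _ _ ab] unfolding good_def nonexpansive_on_def by blast
      finally show ?thesis .
    qed
    moreover have "(\<lambda>n. N ((a *\<^sub>R S (w n) + b *\<^sub>R S' (w n)) - w n)) \<longlonglongrightarrow> 0"
    proof (rule tendsto_sandwich[OF _ _ tendsto_const])
      show "(\<lambda>n. a * N (S (w n) - w n) + b * N (S' (w n) - w n)) \<longlonglongrightarrow> 0"
        using S by (intro tendsto_add_zero tendsto_mult_right_zero) (auto simp: good_def)
    qed (use N_convex_combination[OF ab(1,2)] split N_ge_0 in auto)
    moreover have "a *\<^sub>R S u + b *\<^sub>R S' u \<in> C" if "u \<in> C" for u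
      using S that Cprops(3) ab by (auto simp: good_def intro: convexD)
    ultimately show ?thesis by (auto simp: good_def nonexpansive_on_def)
  qed
  define Orb where "Orb = {S l |S. good S}"
  have OC: "Orb \<subseteq> C" using l by (auto simp: Orb_def good_def)
  have "closure Orb = C"
  proof (rule minimal_invariant_eq[OF C])
    show "closure Orb \<subseteq> C" using OC Cprops(2) by (rule closure_minimal)
    show "closure Orb \<noteq> {}" using good_id by (auto simp: Orb_def)
    show "closed (closure Orb)" by simp
    show "convex (closure Orb)"
    proof (rule convex_closure, rule convexI)
      fix x y and a b :: real
      assume xy: "x \<in> Orb" "y \<in> Orb" and ab: "0 \<le> a" "0 \<le> b" "a + b = 1"
      then obtain S S' where S: "good S" "good S'" "x = S l" "y = S' l" by (auto simp: Orb_def)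
      show "a *\<^sub>R x + b *\<^sub>R y \<in> Orb"
        unfolding Orb_def S(3,4) using good_convex[OF S(1,2) ab]
        by (intro CollectI exI[of _ "\<lambda>x. a *\<^sub>R S x + b *\<^sub>R S' x"] conjI refl)
    qed
    fix x assume "x \<in> closure Orb"
    then obtain z where z: "\<And>n. z n \<in> Orb" "z \<longlonglongrightarrow> x" by (auto simp: closure_sequential)
    have xC: "x \<in> C" using \<open>x \<in> closure Orb\<close> \<open>closure Orb \<subseteq> C\<close> by blast
    have TO: "T (z n) \<in> Orb" for n
    proof -
      obtain S where S: "good S" "z n = S l" using z(1)[of n] by (auto simp: Orb_def)
      then show ?thesis
        unfolding Orb_def S(2)
        by (intro CollectI exI[of _ "\<lambda>x. T (S x)"] conjI refl good_T)
    qed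
    have "(\<lambda>n. T (z n)) \<longlonglongrightarrow> T x"
    proof (rule LIM_zero_cancel, rule Lim_null_comparison)
      show "(\<lambda>n. N (z n - x) / c) \<longlonglongrightarrow> 0"
        using tendsto_divide[OF N_diff_tendsto[OF z(2), of x] tendsto_const[of c]] c_pos by (simp add: N_zero)
      have "norm (T (z n) - T x) \<le> N (z n - x) / c" for n
      proof -
        have "N (T (z n) - T x) \<le> N (z n - x)"
          using T z(1) OC xC by (auto simp: nonexpansive_on_def)
        then have "norm (T (z n) - T x) * c \<le> N (z n - x)"
          using lower[of "T (z n) - T x"] by (simp add: mult.commute)
        then show ?thesis using c_pos by (simp add: field_simps)
      qed
      then show "\<forall>\<^sub>F n in sequentially. norm (T (z n) - T x) \<le> N (z n - x) / c" by simp
    qed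
    then show "T x \<in> closure Orb"
      unfolding closure_sequential using TO by (intro exI[of _ "\<lambda>n. T (z n)"]) simp
  qed
  moreover have "closure Orb \<subseteq> F"
    by (rule closure_minimal) (use F in \<open>auto simp: Orb_def good_def\<close>)
  ultimately show ?thesis by simp
qed

end

section \<open>Functions descending along segments towards a weakly convergent sequence\<close>

text \<open>
The condition \<open>seg\<close> concerns one segment at a time. As \<open>\<phi>\<close> is Lipschitz, the bound for one
  pair \<open>(u, t)\<close> extends to a neighbourhood with the same threshold for \<open>n\<close>, and compactness of
  \<open>H \<times> {0..1}\<close> leaves finitely many thresholds.
\<close>

lemma eventually_segments_below_uniformly:
  fixes \<phi> :: "'v::real_normed_vector \<Rightarrow> real"
  assumes C: "convex C" "bounded C" and w: "\<And>n. w n \<in> C"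
    and lip: "\<And>u v. u \<in> C \<Longrightarrow> v \<in> C \<Longrightarrow> \<bar>\<phi> u - \<phi> v\<bar> \<le> L * norm (u - v)" and L: "0 \<le> L"
    and seg: "\<And>u t \<eta>. \<lbrakk>u \<in> C; 0 \<le> t; t \<le> 1; \<phi> u < \<eta>\<rbrakk> \<Longrightarrow>
                \<forall>\<^sub>F n in sequentially. \<phi> ((1 - t) *\<^sub>R u + t *\<^sub>R w n) < \<eta>"
    and H: "compact H" "H \<subseteq> C" "\<And>u. u \<in> H \<Longrightarrow> \<phi> u < \<eta>"
  shows "\<forall>\<^sub>F n in sequentially. \<forall>u\<in>H. \<forall>t\<in>{0..1}. \<phi> ((1 - t) *\<^sub>R u + t *\<^sub>R w n) < \<eta>"
proof -
  obtain R where R: "\<And>x. x \<in> C \<Longrightarrow> norm x \<le> R" "R > 0" using C(2) by (auto simp: bounded_pos)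
  define v where "v p n = (1 - snd p) *\<^sub>R fst p + snd p *\<^sub>R w n" for p :: "'v \<times> real" and n
  have v_C: "v p n \<in> C" if "p \<in> H \<times> {0..1}" for p n
    unfolding v_def using that H(2) w C(1) by (intro convexD) auto
  have v_diff: "norm (v p n - v q n) \<le> (1 + 2 * R) * dist p q" if pq: "p \<in> H \<times> {0..1}" "q \<in> H \<times> {0..1}" for p q n
  proof -
    have "v p n - v q n = (1 - snd p) *\<^sub>R (fst p - fst q) + (snd p - snd q) *\<^sub>R (w n - fst q)"
      by (simp add: v_def algebra_simps)
    then have "norm (v p n - v q n) \<le> norm ((1 - snd p) *\<^sub>R (fst p - fst q)) + norm ((snd p - snd q) *\<^sub>R (w n - fst q))"
      using norm_triangle_ineq[of "(1 - snd p) *\<^sub>R (fst p - fst q)"] by (simp only:)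
    also have "\<dots> = \<bar>1 - snd p\<bar> * norm (fst p - fst q) + \<bar>snd p - snd q\<bar> * norm (w n - fst q)" by simp
    also have "\<dots> \<le> 1 * dist p q + dist p q * (2 * R)"
    proof (intro add_mono mult_mono)
      show "\<bar>1 - snd p\<bar> \<le> 1" using pq by auto
      show "norm (fst p - fst q) \<le> dist p q" using dist_fst_le[of p q] by (simp add: dist_norm)
      show "\<bar>snd p - snd q\<bar> \<le> dist p q" using dist_snd_le[of p q] by (simp add: dist_real_def)
      show "norm (w n - fst q) \<le> 2 * R"
        using norm_triangle_ineq4[of "w n" "fst q"] R(1)[OF w, of n] R(1)[of "fst q"] pq H(2) by auto
    qed auto
    finally show ?thesis by (simp add: algebra_simps)
  qed
  have "\<exists>\<delta>>0. \<forall>\<^sub>F n in sequentially. \<forall>q\<in>(H \<times> {0..1}) \<inter> ball p \<delta>. \<phi> (v q n) < \<eta>"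
    if p: "p \<in> H \<times> {0..1}" for p
  proof -
    \<comment> \<open>The gap between \<open>\<eta>'\<close> and \<open>\<eta>\<close> absorbs the Lipschitz error on the neighbourhood.\<close>
    define \<eta>' where "\<eta>' = (\<phi> (fst p) + \<eta>) / 2"
    have \<eta>': "\<phi> (fst p) < \<eta>'" "\<eta>' < \<eta>" using H(3)[of "fst p"] p by (auto simp: \<eta>'_def)
    have ev: "\<forall>\<^sub>F n in sequentially. \<phi> (v p n) < \<eta>'"
      unfolding v_def using p H(2) \<eta>'(1) by (intro seg) auto
    define M where "M = L * (1 + 2 * R) + 1"
    have M: "M > 0" using L R(2) by (simp add: M_def add_nonneg_pos)
    have "\<forall>\<^sub>F n in sequentially. \<forall>q\<in>(H \<times> {0..1}) \<inter> ball p ((\<eta> - \<eta>') / M). \<phi> (v q n) < \<eta>"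
      using ev
    proof (eventually_elim, intro ballI)
      case (elim n)
      fix q assume q: "q \<in> (H \<times> {0..1}) \<inter> ball p ((\<eta> - \<eta>') / M)"
      have "\<phi> (v q n) - \<phi> (v p n) \<le> L * norm (v q n - v p n)"
        using lip[OF v_C v_C, of q p n n] p q by auto
      also have "\<dots> \<le> L * ((1 + 2 * R) * dist q p)"
        using v_diff[of q p n] p q L by (intro mult_left_mono) auto
      also have "\<dots> \<le> M * dist p q" by (simp add: M_def algebra_simps dist_commute)
      also have "\<dots> < \<eta> - \<eta>'" using q M by (simp add: field_simps)
      finally show "\<phi> (v q n) < \<eta>" using elim by linarith
    qed
    then show ?thesis using \<eta>'(2) M by (intro exI[of _ "(\<eta> - \<eta>') / M"]) auto
  qed
  then have "\<forall>p\<in>H \<times> {0..1}. \<exists>\<delta>. \<delta> > 0 \<and>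
      (\<forall>\<^sub>F n in sequentially. \<forall>q\<in>(H \<times> {0..1}) \<inter> ball p \<delta>. \<phi> (v q n) < \<eta>)" by blast
  from bchoice[OF this] obtain \<delta> where "\<forall>p\<in>H \<times> {0..1}. \<delta> p > 0 \<and>
      (\<forall>\<^sub>F n in sequentially. \<forall>q\<in>(H \<times> {0..1}) \<inter> ball p (\<delta> p). \<phi> (v q n) < \<eta>)" ..
  note \<delta> = this[THEN bspec, THEN conjunct1] this[THEN bspec, THEN conjunct2]
  have "compact (H \<times> {0..1::real})" by (intro compact_Times H(1)) simp
  moreover have "H \<times> {0..1::real} \<subseteq> (\<Union>p\<in>H \<times> {0..1}. ball p (\<delta> p))"
  proof
    fix p assume "p \<in> H \<times> {0..1::real}"
    then show "p \<in> (\<Union>p\<in>H \<times> {0..1}. ball p (\<delta> p))" using \<delta>(1)[of p] by (intro UN_I[of p]) auto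
  qed
  ultimately obtain D where D: "D \<subseteq> H \<times> {0..1}" "finite D" "H \<times> {0..1} \<subseteq> (\<Union>p\<in>D. ball p (\<delta> p))"
    by (elim compactE_image) auto
  have "\<forall>\<^sub>F n in sequentially. \<forall>p\<in>D. \<forall>q\<in>(H \<times> {0..1}) \<inter> ball p (\<delta> p). \<phi> (v q n) < \<eta>"
    using D \<delta>(2) by (intro eventually_ball_finite) auto
  then show ?thesis
  proof (eventually_elim, intro ballI)
    case (elim n)
    fix u and t :: real assume ut: "u \<in> H" "t \<in> {0..1}"
    then obtain p where "p \<in> D" "(u, t) \<in> ball p (\<delta> p)" using D(3) by blast
    then have "\<phi> (v (u, t) n) < \<eta>" using elim ut by blast
    then show "\<phi> ((1 - t) *\<^sub>R u + t *\<^sub>R w n) < \<eta>" by (simp add: v_def)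
  qed
qed

text \<open>
Finite sets \<open>F k\<close> with \<open>\<phi> < \<eta>\<close> on their convex hulls are enlarged one term \<open>w n\<close> at a time: the hull
  of the enlarged set consists of the segments from the compact old hull to \<open>w n\<close>. No accuracy is lost
  in a step, so \<open>\<phi> < \<eta>\<close> on the union \<open>M\<close> of all hulls. The set \<open>M\<close> is convex and contains infinitely many
  terms, so the weak limit is in its norm closure.
\<close>

lemma weak_limit_le_if_segments_descend:
  fixes \<phi> :: "'v::real_normed_vector \<Rightarrow> real"
  assumes C: "convex C" "bounded C" and w: "\<And>n. w n \<in> C"
    and l: "limitin (weak_topology norm) w l sequentially" "l \<in> C"
    and lip: "\<And>u v. u \<in> C \<Longrightarrow> v \<in> C \<Longrightarrow> \<bar>\<phi> u - \<phi> v\<bar> \<le> L * norm (u - v)" and L: "0 \<le> L"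
    and seg: "\<And>u t \<eta>. \<lbrakk>u \<in> C; 0 \<le> t; t \<le> 1; \<phi> u < \<eta>\<rbrakk> \<Longrightarrow>
                \<forall>\<^sub>F n in sequentially. \<phi> ((1 - t) *\<^sub>R u + t *\<^sub>R w n) < \<eta>"
    and \<eta>: "\<forall>\<^sub>F n in sequentially. \<phi> (w n) < \<eta>"
  shows "\<phi> l \<le> \<eta>"
proof -
  define P where "P F \<longleftrightarrow> finite F \<and> F \<noteq> {} \<and> F \<subseteq> C \<and> (\<forall>u\<in>convex hull F. \<phi> u < \<eta>)" for F
  obtain n0 where n0: "\<phi> (w n0) < \<eta>" using \<eta> by (auto simp: eventually_sequentially)
  have "\<exists>F. \<forall>k::nat. P (F k) \<and> (F k \<subseteq> F (Suc k) \<and> (\<exists>n\<ge>k. w n \<in> F (Suc k)))"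
  proof (rule dependent_nat_choice)
    have "P {w n0}" using n0 w by (simp add: P_def)
    then show "\<exists>F. P F" by blast
  next
    fix F and k :: nat assume F: "P F"
    have hull_C: "convex hull F \<subseteq> C" using F C(1) by (intro hull_minimal) (auto simp: P_def)
    have "\<forall>\<^sub>F n in sequentially. \<forall>u\<in>convex hull F. \<forall>t\<in>{0..1}. \<phi> ((1 - t) *\<^sub>R u + t *\<^sub>R w n) < \<eta>"
      by (rule eventually_segments_below_uniformly[OF C w lip L seg _ hull_C])
         (use F finite_imp_compact_convex_hull in \<open>auto simp: P_def\<close>)
    then obtain n where n: "n \<ge> k"
      "\<And>u t. u \<in> convex hull F \<Longrightarrow> t \<in> {0..1} \<Longrightarrow> \<phi> ((1 - t) *\<^sub>R u + t *\<^sub>R w n) < \<eta>"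
      unfolding eventually_sequentially by (meson nat_le_linear order_refl)
    have "\<phi> u < \<eta>" if u: "u \<in> convex hull (insert (w n) F)" for u
    proof -
      obtain t x where "u = (1 - t) *\<^sub>R w n + t *\<^sub>R x" "0 \<le> t" "t \<le> 1" "x \<in> convex hull F"
        using u F unfolding convex_hull_insert_alt P_def by auto
      then show ?thesis using n(2)[of x "1 - t"] by (simp add: add.commute)
    qed
    then have "P (insert (w n) F)" using F w by (auto simp: P_def)
    then show "\<exists>F'. P F' \<and> F \<subseteq> F' \<and> (\<exists>n\<ge>k. w n \<in> F')" using n(1) by blast
  qed
  then obtain F where F: "\<And>k. P (F k)" "\<And>k. F k \<subseteq> F (Suc k)" "\<And>k. \<exists>n\<ge>k. w n \<in> F (Suc k)"
    by blast
  have F_mono: "F i \<subseteq> F j" if "i \<le> j" for i j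
    using lift_Suc_mono_le[of F, OF F(2) that] .
  define M where "M = (\<Union>k. convex hull (F k))"
  have "convex M" unfolding M_def
  proof (rule convexI)
    fix x y and a b :: real
    assume xy: "x \<in> (\<Union>k. convex hull (F k))" "y \<in> (\<Union>k. convex hull (F k))"
      and ab: "0 \<le> a" "0 \<le> b" "a + b = 1"
    then obtain i j where ij: "x \<in> convex hull (F i)" "y \<in> convex hull (F j)" by blast
    have "x \<in> convex hull (F (max i j))" "y \<in> convex hull (F (max i j))"
      using ij hull_mono[OF F_mono[of i "max i j"]] hull_mono[OF F_mono[of j "max i j"]] by auto
    then have "a *\<^sub>R x + b *\<^sub>R y \<in> convex hull (F (max i j))"
      by (intro convexD[OF convex_convex_hull] ab)
    then show "a *\<^sub>R x + b *\<^sub>R y \<in> (\<Union>k. convex hull (F k))" by blast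
  qed
  have M_C: "M \<subseteq> C" unfolding M_def using F(1) C(1) by (intro UN_least hull_minimal) (auto simp: P_def)
  have M_less: "\<phi> u < \<eta>" if "u \<in> M" for u using that F(1) by (auto simp: M_def P_def)
  have "l \<in> closure M"
  proof (rule ccontr)
    assume "l \<notin> closure M"
    moreover have "closedin (weak_topology norm) (closure M)"
      by (intro closedin_weak_topology_convex convex_closure \<open>convex M\<close>) simp
    then have "openin (weak_topology norm) (- closure M)" by (simp add: closedin_def Compl_eq_Diff_UNIV)
    ultimately have "\<forall>\<^sub>F n in sequentially. w n \<in> - closure M" using l(1) by (auto simp: limitin_def)
    then obtain k where k: "\<And>n. n \<ge> k \<Longrightarrow> w n \<notin> closure M" by (auto simp: eventually_sequentially)
    obtain n where n: "n \<ge> k" "w n \<in> F (Suc k)" using F(3) by blast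
    then have "w n \<in> M" unfolding M_def by (intro UN_I[of "Suc k"] hull_inc) auto
    then show False using k[OF n(1)] closure_subset by blast
  qed
  show ?thesis
  proof (rule field_le_epsilon)
    fix e :: real assume e: "e > 0"
    then have "e / (L + 1) > 0" using L by simp
    then obtain u where u: "u \<in> M" "dist u l < e / (L + 1)"
      using \<open>l \<in> closure M\<close> unfolding closure_approachable by blast
    have "L * norm (l - u) \<le> (L + 1) * norm (l - u)" by (simp add: algebra_simps)
    also have "\<dots> \<le> e" using u(2) L by (simp add: dist_norm norm_minus_commute field_simps)
    finally show "\<phi> l \<le> \<eta> + e" using lip[OF l(2), of u] M_less[OF u(1)] M_C u(1) by fastforce
  qed
qed

section \<open>Direct sums with a strictly monotone norm\<close>

lemma strictly_monotone_norm_axes: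
  assumes Z: "strictly_monotone_norm nZ"
  shows "nZ (1, 0) > 0" "nZ (0, 1) > 0" "nZ (a, 0) = \<bar>a\<bar> * nZ (1, 0)" "nZ (0, a) = \<bar>a\<bar> * nZ (0, 1)"
proof -
  have nz: "is_norm nZ" using Z by (simp add: strictly_monotone_norm_def)
  have zero: "nZ (0, 0) = 0" using nz by (simp add: is_norm_def zero_prod_def)
  show "nZ (1, 0) > 0" "nZ (0, 1) > 0"
    using Z zero unfolding strictly_monotone_norm_def by (metis order_refl zero_less_one zero_le_one)+
  have "nZ (a *\<^sub>R (1, 0)) = \<bar>a\<bar> * nZ (1, 0)" "nZ (a *\<^sub>R (0, 1)) = \<bar>a\<bar> * nZ (0, 1)"
    using nz unfolding is_norm_def by blast+
  then show "nZ (a, 0) = \<bar>a\<bar> * nZ (1, 0)" "nZ (0, a) = \<bar>a\<bar> * nZ (0, 1)" by simp_all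
qed

lemma strictly_monotone_norm_add_le:
  assumes Z: "strictly_monotone_norm nZ"
  shows "nZ (a + s, b + t) \<le> nZ (a, b) + (\<bar>s\<bar> * nZ (1, 0) + \<bar>t\<bar> * nZ (0, 1))"
proof -
  have tri: "nZ (u + v) \<le> nZ u + nZ v" for u v
    using Z unfolding strictly_monotone_norm_def is_norm_def by blast
  have "nZ (a + s, b + t) \<le> nZ (a, b) + nZ (s, t)" using tri[of "(a, b)" "(s, t)"] by simp
  also have "nZ (s, t) \<le> nZ (s, 0) + nZ (0, t)" using tri[of "(s, 0)" "(0, t)"] by simp
  finally show ?thesis 
    unfolding strictly_monotone_norm_axes(3)[OF Z, of s] strictly_monotone_norm_axes(4)[OF Z, of t] by simp
qed

text \<open>
Strict monotonicity in the second coordinate is uniform while the first one stays in a compact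
  interval, because \<open>nZ\<close> is continuous.
\<close>

lemma strictly_monotone_norm_uniform_gap:
  assumes Z: "strictly_monotone_norm nZ" and b: "0 \<le> b" "b < b'"
  obtains \<kappa> where "\<kappa> > 0" "\<And>a. 0 \<le> a \<Longrightarrow> a \<le> A \<Longrightarrow> nZ (a, b) + \<kappa> \<le> nZ (a, b')"
proof (cases "0 \<le> A")
  case False
  show ?thesis by (rule that[of 1]) (use False in auto)
next
  case True
  have lip: "nZ (a, s) \<le> nZ (a', s) + nZ (1, 0) * \<bar>a - a'\<bar>" for a a' s
    using strictly_monotone_norm_add_le[OF Z, of a' "a - a'" s 0] by (simp add: mult.commute)
  have "(nZ (1, 0))-lipschitz_on {0..A} (\<lambda>a. nZ (a, s))" for s
  proof (rule lipschitz_onI)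
    show "dist (nZ (a, s)) (nZ (a', s)) \<le> nZ (1, 0) * dist a a'" for a a'
      using lip[of a s a'] lip[of a' s a] by (simp add: dist_real_def abs_le_iff abs_minus_commute)
  qed (use strictly_monotone_norm_axes(1)[OF Z] in simp)
  then have "continuous_on {0..A} (\<lambda>a. nZ (a, b') - nZ (a, b))"
    by (intro continuous_on_diff lipschitz_on_continuous_on)
  then obtain a0 where a0: "a0 \<in> {0..A}"
    "\<And>a. a \<in> {0..A} \<Longrightarrow> nZ (a0, b') - nZ (a0, b) \<le> nZ (a, b') - nZ (a, b)"
    using continuous_attains_inf[of "{0..A}" "\<lambda>a. nZ (a, b') - nZ (a, b)"] True by auto
  show ?thesis
  proof (rule that)
    show "nZ (a0, b') - nZ (a0, b) > 0"
      using Z b a0(1) unfolding strictly_monotone_norm_def by simp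
    show "nZ (a, b) + (nZ (a0, b') - nZ (a0, b)) \<le> nZ (a, b')" if "0 \<le> a" "a \<le> A" for a
      using a0(2)[of a] that by simp
  qed
qed

lemma direct_sum_norm_diff:
  "direct_sum_norm nZ (u - v) = nZ (norm (fst u - fst v), norm (snd u - snd v))"
  by (simp add: direct_sum_norm_def split_beta)

lemma direct_sum_norm_bounds:
  assumes Z: "strictly_monotone_norm nZ"
  shows "nZ (1, 0) * norm (fst u) \<le> direct_sum_norm nZ u" "nZ (0, 1) * norm (snd u) \<le> direct_sum_norm nZ u"
    "direct_sum_norm nZ u \<le> nZ (1, 0) * norm (fst u) + nZ (0, 1) * norm (snd u)"
  using strictly_monotone_norm_mono[OF Z, of "norm (fst u)" "norm (fst u)" 0 "norm (snd u)"]
    strictly_monotone_norm_mono[OF Z, of 0 "norm (fst u)" "norm (snd u)" "norm (snd u)"]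
    strictly_monotone_norm_add_le[OF Z, of 0 "norm (fst u)" 0 "norm (snd u)"]
    strictly_monotone_norm_axes(3)[OF Z, of 0]
  by (simp_all add: strictly_monotone_norm_axes(3)[OF Z, of "norm (fst u)"]
      strictly_monotone_norm_axes(4)[OF Z, of "norm (snd u)"] direct_sum_norm_def split_beta mult.commute)

lemma equivalent_norm_direct_sum_norm:
  assumes Z: "strictly_monotone_norm nZ"
  obtains c K where
    "equivalent_norm (direct_sum_norm nZ :: 'a::real_normed_vector \<times> 'b::real_normed_vector \<Rightarrow> real) c K"
proof -
  let ?p = "nZ (1, 0)" and ?q = "nZ (0, 1)"
  have pq: "?p > 0" "?q > 0" using strictly_monotone_norm_axes(1,2)[OF Z] by auto
  have "equivalent_norm (direct_sum_norm nZ :: 'a \<times> 'b \<Rightarrow> real) (min ?p ?q / 2) (?p + ?q)"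
  proof
    show "is_norm (direct_sum_norm nZ :: 'a \<times> 'b \<Rightarrow> real)" by (rule is_norm_direct_sum_norm[OF Z])
    show "min ?p ?q / 2 > 0" using pq by simp
    fix u :: "'a \<times> 'b"
    have "min ?p ?q * norm u \<le> min ?p ?q * (norm (fst u) + norm (snd u))"
      using pq norm_Pair_le[of "fst u" "snd u"] by (intro mult_left_mono) auto
    also have "\<dots> \<le> ?p * norm (fst u) + ?q * norm (snd u)"
      unfolding distrib_left by (intro add_mono mult_right_mono) auto
    also have "\<dots> \<le> 2 * direct_sum_norm nZ u" using direct_sum_norm_bounds[OF Z, of u] by simp
    finally show "min ?p ?q / 2 * norm u \<le> direct_sum_norm nZ u" by simp
    have "direct_sum_norm nZ u \<le> ?p * norm (fst u) + ?q * norm (snd u)"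
      by (rule direct_sum_norm_bounds[OF Z])
    also have "\<dots> \<le> (?p + ?q) * norm u"
      unfolding distrib_right using pq norm_fst_le[of "fst u" "snd u"] norm_snd_le[of "snd u" "fst u"]
      by (intro add_mono mult_left_mono) auto
    finally show "direct_sum_norm nZ u \<le> (?p + ?q) * norm u" .
  qed
  then show ?thesis by (rule that)
qed

lemma frequently_less_if_less_limsup:
  fixes f :: "nat \<Rightarrow> ereal"
  assumes "C < limsup f"
  shows "\<exists>\<^sub>F n in sequentially. C < f n"
proof (rule ccontr)
  assume "\<not> ?thesis"
  then have "\<forall>\<^sub>F n in sequentially. f n \<le> C" by (simp add: not_frequently not_less)
  then have "limsup f \<le> C" by (rule Limsup_bounded)
  with assms show False by simp
qed

text \<open>
The definition of GGLD rescaled from norm limit \<open>1\<close> to norm limit \<open>b\<close>, with the iterated upper limit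
  unfolded into a statement about single terms of the sequence.
\<close>

lemma GGLD_frequently_separated:
  fixes y :: "nat \<Rightarrow> 'b::real_normed_vector"
  assumes G: "GGLD (norm :: 'b \<Rightarrow> real)" and y: "limitin (weak_topology norm) y 0 sequentially"
    and b: "(\<lambda>n. norm (y n)) \<longlonglongrightarrow> b" "b > 0"
  obtains c where "1 < c" "\<exists>\<^sub>F m in sequentially. \<exists>\<^sub>F n in sequentially. c * b < norm (y n - y m)"
proof -
  define z where "z n = (1 / b) *\<^sub>R y n" for n
  have "limitin (weak_topology norm) z 0 sequentially"
    unfolding z_def using limitin_weak_topology_bounded_linear[OF y bounded_linear_scaleR_right[of "1 / b"]] by simp
  moreover have "(\<lambda>n. norm (z n)) \<longlonglongrightarrow> 1"
    using tendsto_mult[OF tendsto_const[of "1 / b"] b(1)] b(2) by (simp add: z_def)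
  ultimately have "1 < limsup (\<lambda>m. limsup (\<lambda>n. ereal (norm (z n - z m))))"
    using G unfolding GGLD_def by blast
  then obtain c where c: "1 < ereal c" "ereal c < limsup (\<lambda>m. limsup (\<lambda>n. ereal (norm (z n - z m))))"
    using ereal_dense2 by blast
  have zb: "c < norm (z n - z m) \<longleftrightarrow> c * b < norm (y n - y m)" for n m
  proof -
    have "norm (z n - z m) = norm (y n - y m) / b"
      using b(2) by (simp add: z_def flip: scaleR_diff_right)
    then show ?thesis using b(2) by (simp add: pos_less_divide_eq)
  qed
  have "\<exists>\<^sub>F m in sequentially. \<exists>\<^sub>F n in sequentially. ereal c < ereal (norm (z n - z m))"
    using frequently_less_if_less_limsup[OF c(2)]
    by (rule frequently_mono[rotated]) (intro allI impI frequently_less_if_less_limsup)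
  then have "\<exists>\<^sub>F m in sequentially. \<exists>\<^sub>F n in sequentially. c * b < norm (y n - y m)" by (simp add: zb)
  moreover have "1 < c" using c(1) by simp
  ultimately show ?thesis using that by blast
qed

text \<open>
If the second coordinates \<open>y n\<close> of \<open>w n - l\<close> do not tend to \<open>0\<close>, pass to a subsequence with
  \<open>norm (y n)\<close> tending to \<open>b > 0\<close>. By GGLD, \<open>norm (y n - y m) > c * b\<close> with \<open>c > 1\<close> for suitable large
  \<open>m\<close> and \<open>n\<close>, whereas \<open>norm (x n - x m)\<close> is at least almost \<open>norm (x m)\<close> since the first coordinates
  \<open>x n\<close> are weakly null. By the uniform gap \<open>N (w n - w m)\<close> then exceeds \<open>N (w m - l)\<close> by a fixed
  amount, although both are close to \<open>d\<close>.
\<close>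

lemma GGLD_imp_snd_tendsto:
  fixes w :: "nat \<Rightarrow> 'a::real_normed_vector \<times> 'b::real_normed_vector"
  assumes Z: "strictly_monotone_norm nZ" and G: "GGLD (norm :: 'b \<Rightarrow> real)"
    and w: "limitin (weak_topology norm) w l sequentially"
    and dl: "(\<lambda>n. direct_sum_norm nZ (w n - l)) \<longlonglongrightarrow> d"
    and dw: "\<And>m. (\<lambda>n. direct_sum_norm nZ (w n - w m)) \<longlonglongrightarrow> d"
  shows "(\<lambda>n. snd (w n)) \<longlonglongrightarrow> snd l"
proof (rule ccontr)
  assume neg: "\<not> ?thesis"
  let ?p = "nZ (1, 0)" and ?q = "nZ (0, 1)"
  have pq: "?p > 0" "?q > 0" using strictly_monotone_norm_axes(1,2)[OF Z] by auto
  define x y where "x n = fst (w n) - fst l" and "y n = snd (w n) - snd l" for n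
  have wl: "direct_sum_norm nZ (w n - l) = nZ (norm (x n), norm (y n))" for n
    by (simp add: direct_sum_norm_diff x_def y_def)
  have ww: "direct_sum_norm nZ (w n - w m) = nZ (norm (x n - x m), norm (y n - y m))" for n m
    by (simp add: direct_sum_norm_diff x_def y_def)
  obtain B where B: "\<And>n. \<bar>direct_sum_norm nZ (w n - l)\<bar> \<le> B"
    using BseqE[OF convergent_imp_Bseq[OF convergentI[OF dl]]] by (metis real_norm_def)
  have xB: "norm (x n) \<le> B / ?p" and yB: "norm (y n) \<le> B / ?q" for n
    using direct_sum_norm_bounds(1,2)[OF Z, of "w n - l"] B[of n] pq
    by (simp_all add: x_def y_def field_simps)
  obtain \<epsilon> where \<epsilon>: "\<epsilon> > 0" "\<exists>\<^sub>F n in sequentially. \<epsilon> \<le> norm (y n)"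
    using neg unfolding tendsto_iff dist_norm y_def by (auto simp: not_eventually not_less)
  then have "infinite {n. \<epsilon> \<le> norm (y n)}"
    by (simp add: frequently_cofinite flip: cofinite_eq_sequentially)
  then obtain s0 :: "nat \<Rightarrow> nat" where s0: "strict_mono s0" "\<And>n. \<epsilon> \<le> norm (y (s0 n))"
    using infinite_enumerate by blast
  have "seq_compact {\<epsilon>..B / ?q}" by (simp add: compact_imp_seq_compact)
  then obtain b r where b: "b \<in> {\<epsilon>..B / ?q}" "strict_mono r" "((\<lambda>n. norm (y (s0 n))) \<circ> r) \<longlonglongrightarrow> b"
    using s0(2) yB by (elim seq_compactE[where f = "\<lambda>n. norm (y (s0 n))"]) auto
  define s where "s = s0 \<circ> r"
  have s: "strict_mono s" unfolding s_def by (rule strict_mono_o[OF s0(1) b(2)])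
  have yb: "(\<lambda>n. norm (y (s n))) \<longlonglongrightarrow> b" using b(3) by (simp add: s_def o_def)
  have b0: "b > 0" using b(1) \<epsilon>(1) by simp
  have ws: "limitin (weak_topology norm) (\<lambda>n. w (s n) - l) 0 sequentially"
    using limitin_weak_topology_diff_const[OF limitin_subsequence[OF s w], of l] by (simp add: o_def)
  have xs: "limitin (weak_topology norm) (\<lambda>n. x (s n)) 0 sequentially"
    using limitin_weak_topology_bounded_linear[OF ws bounded_linear_fst] by (simp add: x_def)
  have ys: "limitin (weak_topology norm) (\<lambda>n. y (s n)) 0 sequentially"
    using limitin_weak_topology_bounded_linear[OF ws bounded_linear_snd] by (simp add: y_def)
  obtain c where c: "1 < c"
    "\<exists>\<^sub>F m in sequentially. \<exists>\<^sub>F n in sequentially. c * b < norm (y (s n) - y (s m))"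
    by (rule GGLD_frequently_separated[OF G ys yb b0]) (rule that)
  \<comment> \<open>Any value strictly between \<open>b\<close> and \<open>c * b\<close> will do.\<close>
  define b1 where "b1 = (1 + c) / 2 * b"
  have b1: "0 \<le> b1" "b < b1" "b1 < c * b" using b0 c(1) by (auto simp: b1_def field_simps)
  obtain \<kappa> where \<kappa>: "\<kappa> > 0" "\<And>a. 0 \<le> a \<Longrightarrow> a \<le> B / ?p \<Longrightarrow> nZ (a, b1) + \<kappa> \<le> nZ (a, c * b)"
    by (rule strictly_monotone_norm_uniform_gap[OF Z b1(1,3)]) (rule that)
  have "(\<lambda>n. direct_sum_norm nZ (w (s n) - l)) \<longlonglongrightarrow> d"
    using LIMSEQ_subseq_LIMSEQ[OF dl s] by (simp add: o_def)
  then have "\<forall>\<^sub>F m in sequentially. d - \<kappa> / 3 < direct_sum_norm nZ (w (s m) - l)"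
    using \<kappa>(1) by (intro order_tendstoD) auto
  moreover have "\<forall>\<^sub>F m in sequentially. norm (y (s m)) < b1" using yb b1(2) by (rule order_tendstoD)
  ultimately have "\<forall>\<^sub>F m in sequentially. d - \<kappa> / 3 < direct_sum_norm nZ (w (s m) - l) \<and> norm (y (s m)) < b1"
    by (rule eventually_conj)
  then obtain m where m: "\<exists>\<^sub>F n in sequentially. c * b < norm (y (s n) - y (s m))"
    "d - \<kappa> / 3 < direct_sum_norm nZ (w (s m) - l)" "norm (y (s m)) < b1"
    using frequently_ex[OF frequently_eventually_conj[OF c(2)]] by blast
  \<comment> \<open>Shortening the first coordinate by \<open>\<delta>\<close> costs \<open>\<kappa> / 3\<close> in \<open>nZ\<close>; two further errors of this size remain within the gap \<open>\<kappa>\<close>.\<close>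
  define \<delta> where "\<delta> = \<kappa> / (3 * ?p)"
  have \<delta>: "\<delta> > 0" "\<delta> * ?p = \<kappa> / 3" using \<kappa>(1) pq by (auto simp: \<delta>_def)
  have "(\<lambda>n. direct_sum_norm nZ (w (s n) - w (s m))) \<longlonglongrightarrow> d"
    using LIMSEQ_subseq_LIMSEQ[OF dw s] by (simp add: o_def)
  then have "\<forall>\<^sub>F n in sequentially. direct_sum_norm nZ (w (s n) - w (s m)) < d + \<kappa> / 3"
    using \<kappa>(1) by (intro order_tendstoD) auto
  moreover have "\<forall>\<^sub>F n in sequentially. norm (x (s m)) < norm (x (s n) - x (s m)) + \<delta>"
    by (rule weakly_null_norm_diff[OF xs \<delta>(1)])
  ultimately have "\<forall>\<^sub>F n in sequentially. direct_sum_norm nZ (w (s n) - w (s m)) < d + \<kappa> / 3 \<and>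
      norm (x (s m)) < norm (x (s n) - x (s m)) + \<delta>"
    by (rule eventually_conj)
  then obtain n where n: "c * b < norm (y (s n) - y (s m))"
    "direct_sum_norm nZ (w (s n) - w (s m)) < d + \<kappa> / 3"
    "norm (x (s m)) < norm (x (s n) - x (s m)) + \<delta>"
    using frequently_ex[OF frequently_eventually_conj[OF m(1)]] by blast
  have cb: "0 \<le> c * b" using b1 by simp
  have "d - \<kappa> / 3 + \<kappa> < nZ (norm (x (s m)), norm (y (s m))) + \<kappa>" using m(2) wl by simp
  also have "\<dots> \<le> nZ (norm (x (s m)), b1) + \<kappa>"
    using strictly_monotone_norm_mono[OF Z] m(3) by simp
  also have "\<dots> \<le> nZ (norm (x (s m)), c * b)" using \<kappa>(2) xB by simp
  also have "\<dots> \<le> nZ (norm (x (s n) - x (s m)) + \<delta>, c * b)"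
    using strictly_monotone_norm_mono[OF Z] n(3) cb by simp
  also have "\<dots> \<le> nZ (norm (x (s n) - x (s m)), c * b) + \<kappa> / 3"
    using strictly_monotone_norm_add_le[OF Z, of "norm (x (s n) - x (s m))" \<delta> "c * b" 0] \<delta> by simp
  also have "\<dots> \<le> nZ (norm (x (s n) - x (s m)), norm (y (s n) - y (s m))) + \<kappa> / 3"
    using strictly_monotone_norm_mono[OF Z] n(1) cb by simp
  also have "\<dots> < d + \<kappa> / 3 + \<kappa> / 3" using n(2) ww by simp
  finally show False by simp
qed

text \<open>
For \<open>v = (1 - t) *\<^sub>R u + t *\<^sub>R w n\<close> the sum \<open>N (S v - S u) + N (S v - w n)\<close> is at most
  \<open>N (v - u) + N (v - w n) = N (w n - u)\<close> up to a small error, hence at most about \<open>d\<close>. If \<open>snd (S v)\<close>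
  were much farther from \<open>y0\<close> than \<open>snd (S u)\<close>, then the coordinatewise sums of the two distance
  vectors would dominate those of \<open>S u - w n\<close>, with a definite surplus in the second coordinate; by
  the uniform gap their \<open>nZ\<close>-norm would be definitely larger than \<open>N (S u - w n)\<close>, which also tends to
  \<open>d\<close>.
\<close>

lemma snd_descends_along_segments:
  fixes w :: "nat \<Rightarrow> 'a::real_normed_vector \<times> 'b::real_normed_vector"
  assumes Z: "strictly_monotone_norm nZ" and C: "convex C" and w: "\<And>n. w n \<in> C"
    and d: "\<And>u. u \<in> C \<Longrightarrow> (\<lambda>n. direct_sum_norm nZ (w n - u)) \<longlonglongrightarrow> d"
    and y: "(\<lambda>n. snd (w n)) \<longlonglongrightarrow> y0"
    and S: "\<And>u. u \<in> C \<Longrightarrow> S u \<in> C" "nonexpansive_on (direct_sum_norm nZ) C S"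
      "(\<lambda>n. direct_sum_norm nZ (S (w n) - w n)) \<longlonglongrightarrow> 0"
    and u: "u \<in> C" and t: "0 \<le> t" "t \<le> 1" and \<eta>: "norm (snd (S u) - y0) < \<eta>"
  shows "\<forall>\<^sub>F n in sequentially. norm (snd (S ((1 - t) *\<^sub>R u + t *\<^sub>R w n)) - y0) < \<eta>"
proof -
  let ?N = "direct_sum_norm nZ :: 'a \<times> 'b \<Rightarrow> real"
  let ?p = "nZ (1, 0)"
  have p: "?p > 0" using strictly_monotone_norm_axes(1,2)[OF Z] by auto
  obtain c K where "equivalent_norm ?N c K" by (rule equivalent_norm_direct_sum_norm[OF Z])
  then interpret equivalent_norm ?N c K .
  \<comment> \<open>Replacing \<open>y0\<close> by \<open>snd (w n)\<close> costs \<open>h\<close> at each of \<open>S u\<close> and \<open>S v\<close>, and a surplus \<open>h\<close> is left for the gap.\<close>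
  define h where "h = (\<eta> - norm (snd (S u) - y0)) / 3"
  have h: "h > 0" "norm (snd (S u) - y0) + 3 * h = \<eta>" using \<eta> by (simp_all add: h_def field_simps)
  define b where "b = norm (snd (S u) - y0) + h"
  have b: "0 \<le> b" "b < b + h" using h(1) by (auto simp: b_def)
  obtain B where B: "\<And>n. \<bar>?N (w n - S u)\<bar> \<le> B"
    using BseqE[OF convergent_imp_Bseq[OF convergentI[OF d[OF S(1)[OF u]]]]] by (metis real_norm_def)
  obtain \<kappa> where \<kappa>: "\<kappa> > 0" "\<And>a. 0 \<le> a \<Longrightarrow> a \<le> B / ?p \<Longrightarrow> nZ (a, b) + \<kappa> \<le> nZ (a, b + h)"
    by (rule strictly_monotone_norm_uniform_gap[OF Z b]) (rule that)
  have "\<forall>\<^sub>F n in sequentially. dist (snd (w n)) y0 < h" using y h(1) by (rule tendstoD)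
  moreover have "\<forall>\<^sub>F n in sequentially. d - \<kappa> / 4 < ?N (w n - S u)"
    using d[OF S(1)[OF u]] \<kappa>(1) by (intro order_tendstoD) auto
  moreover have "\<forall>\<^sub>F n in sequentially. ?N (w n - u) < d + \<kappa> / 4"
    using d[OF u] \<kappa>(1) by (intro order_tendstoD) auto
  moreover have "\<forall>\<^sub>F n in sequentially. ?N (S (w n) - w n) < \<kappa> / 4"
    using S(3) \<kappa>(1) by (intro order_tendstoD) auto
  ultimately show ?thesis
  proof eventually_elim
    case (elim n)
    define v where "v = (1 - t) *\<^sub>R u + t *\<^sub>R w n"
    have v: "v \<in> C" unfolding v_def using t by (intro convexD[OF C u w]) auto
    show ?case
    proof (rule ccontr)
      assume "\<not> ?thesis"
      then have far: "\<eta> \<le> norm (snd (S v) - y0)" by (simp add: v_def)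
      have near: "norm (snd (w n) - y0) < h" using elim(1) by (simp add: dist_norm)
      have bS: "norm (snd (S u) - snd (w n)) \<le> b"
        using norm_triangle_ineq4[of "snd (S u) - y0" "snd (w n) - y0"] near by (simp add: b_def)
      have bv: "b + h \<le> norm (snd (S v) - snd (w n))"
        using norm_triangle_sub[of "snd (S v) - y0" "snd (w n) - y0"] near far h(2) by (simp add: b_def)
      let ?a = "norm (fst (S u) - fst (w n))"
      have aB: "?a \<le> B / ?p"
        using direct_sum_norm_bounds(1)[OF Z, of "w n - S u"] B[of n] p
        by (simp add: field_simps norm_minus_commute)
      have "?N (v - u) = t * ?N (w n - u)"
      proof -
        have "v - u = t *\<^sub>R (w n - u)" by (simp add: v_def algebra_simps)
        then show ?thesis using t by (simp add: N_scale)
      qed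
      moreover have "?N (v - w n) = (1 - t) * ?N (w n - u)"
      proof -
        have "v - w n = (1 - t) *\<^sub>R (u - w n)" by (simp add: v_def algebra_simps)
        then show ?thesis using t by (simp add: N_scale N_diff_commute[of u])
      qed
      ultimately have seg: "?N (v - u) + ?N (v - w n) = ?N (w n - u)" by (simp add: algebra_simps)
      have "d - \<kappa> / 4 + \<kappa> < nZ (?a, norm (snd (S u) - snd (w n))) + \<kappa>"
        using elim(2) by (simp add: direct_sum_norm_diff norm_minus_commute)
      also have "\<dots> \<le> nZ (?a, b) + \<kappa>" using strictly_monotone_norm_mono[OF Z] bS by simp
      also have "\<dots> \<le> nZ (?a, b + h)" using \<kappa>(2) aB by simp
      also have "\<dots> \<le> nZ (norm (fst (S v) - fst (S u)) + norm (fst (S v) - fst (w n)),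
                      norm (snd (S v) - snd (S u)) + norm (snd (S v) - snd (w n)))"
      proof (rule strictly_monotone_norm_mono[OF Z])
        show "?a \<le> norm (fst (S v) - fst (S u)) + norm (fst (S v) - fst (w n))"
          using norm_triangle_ineq4[of "fst (S v) - fst (w n)" "fst (S v) - fst (S u)"] by simp
        show "b + h \<le> norm (snd (S v) - snd (S u)) + norm (snd (S v) - snd (w n))"
          using bv by (simp add: add_increasing)
      qed (use b h in auto)
      also have "\<dots> \<le> ?N (S v - S u) + ?N (S v - w n)"
      proof -
        have "nZ (z + z') \<le> nZ z + nZ z'" for z z'
          using Z unfolding strictly_monotone_norm_def is_norm_def by blast
        from this[of "(norm (fst (S v) - fst (S u)), norm (snd (S v) - snd (S u)))"
            "(norm (fst (S v) - fst (w n)), norm (snd (S v) - snd (w n)))"]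
        show ?thesis by (simp add: direct_sum_norm_diff)
      qed
      also have "\<dots> \<le> ?N (v - u) + (?N (v - w n) + ?N (S (w n) - w n))"
      proof (rule add_mono)
        show "?N (S v - S u) \<le> ?N (v - u)" using S(2) v u by (simp add: nonexpansive_on_def)
        have "?N (S v - S (w n)) \<le> ?N (v - w n)" using S(2) v w by (simp add: nonexpansive_on_def)
        then show "?N (S v - w n) \<le> ?N (v - w n) + ?N (S (w n) - w n)"
          using N_diff_triangle[of "S v" "w n" "S (w n)"] by simp
      qed
      also have "\<dots> < d + \<kappa> / 4 + \<kappa> / 4" using seg elim(3,4) by simp
      finally show False using \<kappa>(1) by simp
    qed
  qed
qed

text \<open>
The common second coordinate is that of the weak limit \<open>l\<close> of an approximate fixed point sequence.
  For every map \<open>S\<close> sharing this sequence, the function \<open>\<phi> u = norm (snd (S u) - snd l)\<close> descends along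
  segments towards \<open>w\<close> and tends to \<open>0\<close> along \<open>w\<close>, so it vanishes at \<open>l\<close>.
\<close>

lemma minimal_invariant_snd_constant:
  fixes C :: "('a::real_normed_vector \<times> 'b::real_normed_vector) set"
  assumes Z: "strictly_monotone_norm nZ" and G: "GGLD (norm :: 'b \<Rightarrow> real)"
    and C: "compactin (weak_topology norm) C" "minimal_invariant T C"
    and T: "nonexpansive_on (direct_sum_norm nZ) C T"
  obtains y0 where "\<And>u. u \<in> C \<Longrightarrow> snd u = y0"
proof -
  let ?N = "direct_sum_norm nZ :: 'a \<times> 'b \<Rightarrow> real"
  obtain c K where "equivalent_norm ?N c K" by (rule equivalent_norm_direct_sum_norm[OF Z])
  then interpret equivalent_norm ?N c K .
  note Cprops = minimal_invariantD[OF C(2)]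
  have bdd: "bounded C" by (rule weakly_compact_imp_bounded[OF C(1)])
  obtain x0 where x0: "x0 \<in> C" using Cprops(1) by blast
  obtain R where R: "\<And>x. x \<in> C \<Longrightarrow> norm x \<le> R" using bdd by (auto simp: bounded_iff)
  have diam: "?N (x - y) \<le> \<bar>K\<bar> * (2 * R)" if "x \<in> C" "y \<in> C" for x y
  proof -
    have "?N (x - y) \<le> \<bar>K\<bar> * norm (x - y)"
      using upper[of "x - y"] by (meson abs_ge_self mult_right_mono norm_ge_zero order_trans)
    also have "\<dots> \<le> \<bar>K\<bar> * (2 * R)"
      using norm_triangle_ineq4[of x y] R[OF that(1)] R[OF that(2)] by (intro mult_left_mono) auto
    finally show ?thesis .
  qed
  have "\<exists>u. u \<in> C \<and> ?N (T u - u) < inverse (real (Suc n))" for n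
    by (rule exists_approximate_fixed_point[OF Cprops(3) x0 Cprops(4) T diam, of "inverse (real (Suc n))"]) auto
  then have "\<exists>w. \<forall>n. w n \<in> C \<and> ?N (T (w n) - w n) < inverse (real (Suc n))" by (intro choice allI)
  then obtain w' where w': "\<And>n. w' n \<in> C" "\<And>n. ?N (T (w' n) - w' n) < inverse (real (Suc n))" by blast
  have w'0: "(\<lambda>n. ?N (T (w' n) - w' n)) \<longlonglongrightarrow> 0"
    by (rule tendsto_sandwich[OF _ _ tendsto_const LIMSEQ_inverse_real_of_nat])
       (use w'(2) N_ge_0 in \<open>auto intro: less_imp_le always_eventually\<close>)
  obtain r l where r: "strict_mono r" "l \<in> C" "limitin (weak_topology norm) (w' \<circ> r) l sequentially"
    by (rule weakly_compact_imp_weakly_convergent_subsequence[of C w', OF C(1) w'(1)]) (rule that)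
  define w where "w = w' \<circ> r"
  have w: "\<And>n. w n \<in> C" using w'(1) by (simp add: w_def)
  have w0: "(\<lambda>n. ?N (T (w n) - w n)) \<longlonglongrightarrow> 0"
    using LIMSEQ_subseq_LIMSEQ[OF w'0 r(1)] by (simp add: o_def w_def)
  have wl: "limitin (weak_topology norm) w l sequentially" using r(3) by (simp add: w_def)
  obtain d where d: "\<And>u. u \<in> C \<Longrightarrow> (\<lambda>n. ?N (w n - u)) \<longlonglongrightarrow> d"
    by (rule goebel_karlovitz[OF C(2) T bdd w w0 wl r(2)]) (rule that)
  have y: "(\<lambda>n. snd (w n)) \<longlonglongrightarrow> snd l"
    by (rule GGLD_imp_snd_tendsto[OF Z G wl d[OF r(2)] d[OF w]])
  have "C \<subseteq> {u. snd u = snd l}"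
  proof (rule minimal_set_in_closure_of_orbit[OF C(2) T w w0 r(2)])
    show "closed {u :: 'a \<times> 'b. snd u = snd l}" by (intro closed_Collect_eq continuous_intros)
    fix S assume S: "\<And>u. u \<in> C \<Longrightarrow> S u \<in> C" "nonexpansive_on ?N C S" "(\<lambda>n. ?N (S (w n) - w n)) \<longlonglongrightarrow> 0"
    let ?q = "nZ (0, 1)"
    have q: "?q > 0" using strictly_monotone_norm_axes(1,2)[OF Z] by auto
    define \<phi> where "\<phi> u = norm (snd (S u) - snd l)" for u
    have snd_le: "norm (snd z) \<le> ?N z / ?q" for z
      using direct_sum_norm_bounds(2)[OF Z, of z] q by (simp add: field_simps)
    have lip: "\<bar>\<phi> u - \<phi> v\<bar> \<le> (\<bar>K\<bar> / ?q) * norm (u - v)" if "u \<in> C" "v \<in> C" for u v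
    proof -
      have "\<bar>\<phi> u - \<phi> v\<bar> \<le> norm (snd (S u - S v))"
        using norm_triangle_ineq3[of "snd (S u) - snd l" "snd (S v) - snd l"] by (simp add: \<phi>_def)
      also have "\<dots> \<le> ?N (S u - S v) / ?q" by (rule snd_le)
      also have "\<dots> \<le> ?N (u - v) / ?q"
        using S(2) that q by (intro divide_right_mono) (auto simp: nonexpansive_on_def)
      also have "\<dots> \<le> (\<bar>K\<bar> * norm (u - v)) / ?q"
        using upper[of "u - v"] q
        by (intro divide_right_mono) (auto intro: order_trans[OF _ mult_right_mono[OF abs_ge_self]])
      finally show ?thesis by simp
    qed
    have "\<phi> l \<le> \<eta>" if \<eta>: "\<eta> > 0" for \<eta>
    proof (rule weak_limit_le_if_segments_descend[OF Cprops(3) bdd w wl r(2) lip])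
      show "0 \<le> \<bar>K\<bar> / ?q" using q by simp
      show "\<forall>\<^sub>F n in sequentially. \<phi> ((1 - t) *\<^sub>R u + t *\<^sub>R w n) < \<eta>'"
        if "u \<in> C" "0 \<le> t" "t \<le> 1" "\<phi> u < \<eta>'" for u t \<eta>'
        unfolding \<phi>_def
        by (rule snd_descends_along_segments[OF Z Cprops(3) w d y S that(1-3)]) (use that(4) in \<open>auto simp: \<phi>_def\<close>)
      have "\<forall>\<^sub>F n in sequentially. ?N (S (w n) - w n) < \<eta> / 2 * ?q"
        using S(3) by (rule order_tendstoD) (use \<eta> q in simp)
      moreover have "\<forall>\<^sub>F n in sequentially. dist (snd (w n)) (snd l) < \<eta> / 2"
        using y by (rule tendstoD) (use \<eta> in simp)
      ultimately show "\<forall>\<^sub>F n in sequentially. \<phi> (w n) < \<eta>"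
      proof eventually_elim
        case (elim n)
        have "?N (S (w n) - w n) / ?q < \<eta> / 2" using elim(1) q by (simp add: field_simps)
        with snd_le[of "S (w n) - w n"] have "norm (snd (S (w n) - w n)) < \<eta> / 2"
          by (rule order_le_less_trans)
        then have "norm (snd (S (w n)) - snd (w n)) < \<eta> / 2" by simp
        then show ?case
          using norm_triangle_ineq[of "snd (S (w n)) - snd (w n)" "snd (w n) - snd l"] elim(2)
          by (simp add: \<phi>_def dist_norm)
      qed
    qed
    then have "\<phi> l \<le> 0" by (meson dense not_le)
    then show "S l \<in> {u. snd u = snd l}" by (simp add: \<phi>_def)
  qed
  then show ?thesis using that by blast
qed

theorem theorem3p4:
  fixes nZ :: "real \<times> real \<Rightarrow> real"
  assumes "strictly_monotone_norm nZ"
    and "WFPP (norm :: 'a::banach \<Rightarrow> real)"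
    and "GGLD (norm :: 'b::banach \<Rightarrow> real)"
  shows "WFPP (direct_sum_norm nZ :: 'a \<times> 'b \<Rightarrow> real)"
  unfolding WFPP_def
proof (intro allI impI, elim conjE)
  note Z = assms(1)
  let ?N = "direct_sum_norm nZ :: 'a \<times> 'b \<Rightarrow> real"
  obtain c K where eq: "equivalent_norm ?N c K" by (rule equivalent_norm_direct_sum_norm[OF Z])
  then interpret equivalent_norm ?N c K .
  fix C0 :: "('a \<times> 'b) set" and T
  assume C0: "C0 \<noteq> {}" "compactin (weak_topology ?N) C0" "convex C0" "T ` C0 \<subseteq> C0"
    and T0: "nonexpansive_on ?N C0 T"
  have C0': "compactin (weak_topology norm) C0"
    using C0(2) weak_topology_equivalent_norm[OF c_pos lower upper] by simp
  obtain C where C: "C \<subseteq> C0" "minimal_invariant T C"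
    by (rule exists_minimal_invariant[OF C0' C0(3,1,4)]) (rule that)
  note Cprops = minimal_invariantD[OF C(2)]
  have Cc: "compactin (weak_topology norm) C"
    by (rule closed_compactin[OF C0' C(1) closedin_weak_topology_convex[OF Cprops(3,2)]])
  have T: "nonexpansive_on ?N C T" using T0 C(1) by (auto simp: nonexpansive_on_def)
  obtain y0 where y0: "\<And>u. u \<in> C \<Longrightarrow> snd u = y0"
    by (rule minimal_invariant_snd_constant[OF Z assms(3) Cc C(2) T]) (rule that)
  have in_C: "(x, y0) \<in> C" if "x \<in> fst ` C" for x using that y0 by force
  define T' where "T' x = fst (T (x, y0))" for x
  have TT': "T (x, y0) = (T' x, y0)" if "x \<in> fst ` C" for x
    using y0[OF Cprops(4)[OF in_C[OF that]]] by (simp add: T'_def prod_eq_iff)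
  have "\<exists>x\<in>fst ` C. T' x = x"
  proof (rule assms(2)[unfolded WFPP_def, rule_format], intro conjI)
    show "fst ` C \<noteq> {}" using Cprops(1) by simp
    have "continuous_map (weak_topology norm) (weak_topology norm) (fst :: 'a \<times> 'b \<Rightarrow> 'a)"
      by (rule continuous_map_weak_topology_bounded_linear[OF bounded_linear_fst])
    then show "compactin (weak_topology norm) (fst ` C)" by (rule image_compactin[OF Cc])
    show "convex (fst ` C)" by (rule convex_linear_image[OF linear_fst Cprops(3)])
    show "T' ` fst ` C \<subseteq> fst ` C"
    proof
      fix x' assume "x' \<in> T' ` fst ` C"
      then obtain x where "x \<in> fst ` C" "x' = T' x" by blast
      then show "x' \<in> fst ` C" using Cprops(4)[OF in_C] by (auto simp: T'_def)
    qed
    show "nonexpansive_on norm (fst ` C) T'"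
      unfolding nonexpansive_on_def
    proof (intro ballI)
      fix x x' assume x: "x \<in> fst ` C" "x' \<in> fst ` C"
      have "?N (T (x, y0) - T (x', y0)) \<le> ?N ((x, y0) - (x', y0))"
        using T in_C x unfolding nonexpansive_on_def by blast
      then show "norm (T' x - T' x') \<le> norm (x - x')"
        using strictly_monotone_norm_axes(1)[OF Z]
        by (simp add: TT'[OF x(1)] TT'[OF x(2)] direct_sum_norm_def strictly_monotone_norm_axes(3)[OF Z, of "norm (T' x - T' x')"]
              strictly_monotone_norm_axes(3)[OF Z, of "norm (x - x')"])
    qed
  qed
  then obtain x where "x \<in> fst ` C" "T' x = x" by blast
  then have "(x, y0) \<in> C0" "T (x, y0) = (x, y0)" using in_C TT' C(1) by auto
  then show "\<exists>x\<in>C0. T x = x" by blast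
qed

end
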